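(* Let $K \subset \mathbb{R}^2$ be a convex body and let $n \ge 1$ be a real number. Let $X, X'$ be uniformly distributed random points in $K$ and $Y, Y'$ uniformly distributed random points on $\partial K$, all independent. Denote by $|K|$ the area of $K$ and by $|\sigma K|$ its perimeter. 1. If $\dfrac{|K|}{|\sigma K|^2} \ge \dfrac{1}{\sqrt{2(n+2)(n+3)}}$, then $\mathbb{E}|XX'|^n \le \mathbb{E}|YY'|^n$. 2. If $\dfrac{|K|}{|\sigma K|^2} \ge \dfrac{1}{n+3}$, then $\mathbb{E}|XX'|^n \le \mathbb{E}|XY|^n$. 3. If $\dfrac{|K|}{|\sigma K|^2} \ge \dfrac{1}{2(n+2)}$, then $\mathbb{E}|XY|^n \le \mathbb{E}|YY'|^n$.
   Context: A convex body is a convex compact set with non-empty interior. "Uniform in $K$" is with respect to Lebesgue measure; "uniform on $\partial K$" is with respect to arc length. $|AB|$ denotes the Euclidean distance between points $A$ and $B$. *)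

theory Defs
  imports "HOL-Probability.Probability"
begin

definition convex_body :: "'a::euclidean_space set \<Rightarrow> bool" where
  "convex_body K \<longleftrightarrow> convex K \<and> compact K \<and> interior K \<noteq> {}"

text \<open>Length of the curve \<open>g\<close> on \<open>{a..b}\<close>: supremum of the lengths of inscribed polygonal chains.
  Valued in the extended nonnegative reals, so that non-rectifiable curves have length \<open>\<infinity>\<close>.\<close>

definition curve_length :: "(real \<Rightarrow> 'a::metric_space) \<Rightarrow> real \<Rightarrow> real \<Rightarrow> ennreal" where
  "curve_length g a b =
     (SUP (m, t) \<in> {(m::nat, t::nat \<Rightarrow> real). mono_on {..m} t \<and> t ` {..m} \<subseteq> {a..b}}.
        \<Sum>i<m. ennreal (dist (g (t i)) (g (t (Suc i)))))"

definition arclength_loop :: "real \<Rightarrow> (real \<Rightarrow> 'a::metric_space) \<Rightarrow> 'a set \<Rightarrow> bool" where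
  "arclength_loop L g C \<longleftrightarrow>
     0 < L \<and> continuous_on {0..L} g \<and> g L = g 0 \<and> inj_on g {0..<L} \<and> g ` {0..L} = C \<and>
     (\<forall>a b. 0 \<le> a \<and> a \<le> b \<and> b \<le> L \<longrightarrow> curve_length g a b = ennreal (b - a))"

text \<open>Arc length on a rectifiable simple closed curve \<open>C\<close>, as a Borel measure on the ambient space:
  the image of Lebesgue measure on \<open>{0..L}\<close> under an arc-length parametrisation of \<open>C\<close>.
  The parametrisation is unique up to starting point and orientation, so the choice is immaterial.
  Restricting the space to \<open>{0..L}\<close> matters: outside it \<open>g\<close> need not be measurable.\<close>

definition arclength_measure :: "'a::metric_space set \<Rightarrow> 'a measure" where
  "arclength_measure C =
     (case SOME (L, g). arclength_loop L g C of
        (L, g) \<Rightarrow> distr (restrict_space lborel {0..L}) borel g)"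

definition area :: "(real ^ 2) set \<Rightarrow> real" where
  "area K = measure lborel K"

definition perimeter :: "(real ^ 2) set \<Rightarrow> real" where
  "perimeter K = measure (arclength_measure (frontier K)) (frontier K)"

definition uniform_in :: "(real ^ 2) set \<Rightarrow> (real ^ 2) measure" where
  "uniform_in K = uniform_measure lborel K"

definition uniform_on_boundary :: "(real ^ 2) set \<Rightarrow> (real ^ 2) measure" where
  "uniform_on_boundary K = uniform_measure (arclength_measure (frontier K)) (frontier K)"

end

(*
  The polar formula at a point p of K gives the integral of |x - p|^n over K as 1/(n+2) times the
  integral of r^(n+2) over the directions, where r is the distance from p to the boundary.
  Since arc length dominates r times the angle, and r is at most half the perimeter P, this is at
  most P/(2(n+2)) times the integral of |y - p|^n over the boundary. Hence
  E|X - p|^n <= P^2/(2(n+2)|K|) E|Y - p|^n for every p in K. As n >= 1, each of the three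
  hypotheses makes the factor at most 1, so E|XX'|^n <= E|XY|^n <= E|YY'|^n.

  The boundary has an arc-length parametrisation because its radial parametrisation is Lipschitz.
  The polar formula is replaced by a cover of K by N thin sectors over boundary arcs of equal
  length, each contained in a triangle, with N tending to infinity.
*)
theory Submission
  imports Defs
begin

section \<open>Curve length\<close>

text \<open>Two obstacles shape the proof. First, \<open>arclength_measure\<close> is built from a
  loop selected by \<open>SOME\<close>, so \<open>perimeter\<close> and
  \<open>uniform_on_boundary\<close> say nothing until some arc-length loop of the boundary has been
  exhibited. Second, the boundary may have corners, so a sector over a short arc is controlled only
  by the fact that an arc-length parametrisation is 1-Lipschitz. For an arc of length h at distance
  about R from p, the sector has area at most about R h / 2 and the mean of |x - p|^n over it is at
  most about 2 R^n / (n + 2). The product R^(n+1) h / (n + 2) is the source of the exponent n + 1 on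
  the boundary and of the constant n + 2. The relative errors are of order h / R, so p has to keep a
  positive distance from the boundary. Boundary points, which occur because E|XY|^n <= E|YY'|^n is
  obtained by conditioning on Y, are reached by a limit.\<close>

lemma chain_le_curve_length:
  assumes "mono_on {..m} t" "t ` {..m} \<subseteq> {a..b}"
  shows "(\<Sum>i<m. ennreal (dist (g (t i)) (g (t (Suc i))))) \<le> curve_length g a b"
  unfolding curve_length_def using assms
  by (intro SUP_upper2[of "(m, t)"]) auto

lemma curve_length_leI:
  assumes "\<And>m t. mono_on {..m} t \<Longrightarrow> t ` {..m} \<subseteq> {a..b} \<Longrightarrow>
    (\<Sum>i<m. ennreal (dist (g (t i)) (g (t (Suc i))))) \<le> C"
  shows "curve_length g a b \<le> C"
  unfolding curve_length_def using assms by (auto intro!: SUP_least)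

lemma dist_le_curve_length:
  assumes "a \<le> b"
  shows "ennreal (dist (g a) (g b)) \<le> curve_length g a b"
proof -
  define t where "t = (\<lambda>i::nat. if i = 0 then a else b)"
  have "mono_on {..1} t" "t ` {..1} \<subseteq> {a..b}"
    using assms by (auto simp: t_def mono_on_def)
  from chain_le_curve_length[OF this, of g] show ?thesis by (simp add: t_def)
qed

lemma curve_length_le_lipschitz:
  assumes "C-lipschitz_on {a..b} g" "a \<le> b"
  shows "curve_length g a b \<le> ennreal (C * (b - a))"
proof (rule curve_length_leI)
  fix m :: nat and t :: "nat \<Rightarrow> real"
  assume t: "mono_on {..m} t" "t ` {..m} \<subseteq> {a..b}"
  have C: "0 \<le> C" using assms(1) by (rule lipschitz_on_nonneg)
  have step: "dist (g (t i)) (g (t (Suc i))) \<le> C * (t (Suc i) - t i)" if "i < m" for i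
  proof -
    have "t i \<le> t (Suc i)" using t(1) that by (auto simp: mono_on_def)
    moreover have "t i \<in> {a..b}" "t (Suc i) \<in> {a..b}"
      using t(2) that by (auto simp del: atLeastAtMost_iff intro!: subsetD[OF t(2)])
    ultimately show ?thesis
      using lipschitz_onD[OF assms(1), of "t i" "t (Suc i)"] by (simp add: dist_real_def)
  qed
  have "(\<Sum>i<m. ennreal (dist (g (t i)) (g (t (Suc i))))) =
      ennreal (\<Sum>i<m. dist (g (t i)) (g (t (Suc i))))"
    by (rule sum_ennreal) simp
  also have "\<dots> \<le> ennreal (\<Sum>i<m. C * (t (Suc i) - t i))"
    by (intro ennreal_leI sum_mono) (use step in auto)
  also have "(\<Sum>i<m. C * (t (Suc i) - t i)) = C * (t m - t 0)"
    by (simp add: sum_distrib_left[symmetric] sum_lessThan_telescope)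
  also have "ennreal \<dots> \<le> ennreal (C * (b - a))"
  proof (intro ennreal_leI mult_left_mono C)
    have "t 0 \<in> {a..b}" "t m \<in> {a..b}" by (auto simp del: atLeastAtMost_iff intro!: subsetD[OF t(2)])
    then show "t m - t 0 \<le> b - a" by auto
  qed
  finally show "(\<Sum>i<m. ennreal (dist (g (t i)) (g (t (Suc i))))) \<le> ennreal (C * (b - a))" .
qed

lemma curve_length_add:
  assumes "a \<le> b" "b \<le> c"
  shows "curve_length g a c = curve_length g a b + curve_length g b c"
proof (rule antisym)
  show "curve_length g a c \<le> curve_length g a b + curve_length g b c"
  proof (rule curve_length_leI)
    fix m :: nat and t :: "nat \<Rightarrow> real"
    assume t: "mono_on {..m} t" "t ` {..m} \<subseteq> {a..c}"
    \<comment> \<open>Clamping the chain at \<open>b\<close> avoids having to insert \<open>b\<close> as a new vertex.\<close>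
    define u v where "u i = min (t i) b" and "v i = max (t i) b" for i
    have tI: "a \<le> t i" "t i \<le> c" if "i \<le> m" for i using t(2) that by auto
    have step: "ennreal (dist (g (t i)) (g (t (Suc i)))) \<le>
        ennreal (dist (g (u i)) (g (u (Suc i)))) + ennreal (dist (g (v i)) (g (v (Suc i))))" if "i < m" for i
    proof -
      have "t i \<le> t (Suc i)" using t(1) that by (auto simp: mono_on_def)
      then have "dist (g (t i)) (g (t (Suc i))) \<le>
        dist (g (u i)) (g (u (Suc i))) + dist (g (v i)) (g (v (Suc i)))"
        unfolding u_def v_def min_def max_def by (auto intro: dist_triangle)
      then show ?thesis by (simp add: ennreal_leI flip: ennreal_plus)
    qed
    have "mono_on {..m} u" "mono_on {..m} v"
      using t(1) unfolding u_def v_def by (auto intro!: mono_onI min.mono max.mono dest: mono_onD)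
    moreover have "u ` {..m} \<subseteq> {a..b}" "v ` {..m} \<subseteq> {b..c}"
      using tI assms by (auto simp: u_def v_def)
    ultimately have "(\<Sum>i<m. ennreal (dist (g (u i)) (g (u (Suc i)))))
        + (\<Sum>i<m. ennreal (dist (g (v i)) (g (v (Suc i))))) \<le> curve_length g a b + curve_length g b c"
      by (intro add_mono chain_le_curve_length)
    then show "(\<Sum>i<m. ennreal (dist (g (t i)) (g (t (Suc i))))) \<le> curve_length g a b + curve_length g b c"
      by (intro order_trans[OF sum_mono[OF step]]) (auto simp: sum.distrib)
  qed
next
  have sum_split: "sum f {..<k + l} = sum f {..<k} + (\<Sum>i<l. f (k + i))" for f :: "nat \<Rightarrow> ennreal" and k l
    by (induction l) (simp_all add: add.assoc)
  have cat: "(\<Sum>i<m. ennreal (dist (g (t i)) (g (t (Suc i))))) + (\<Sum>i<n. ennreal (dist (g (s i)) (g (s (Suc i)))))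
      \<le> curve_length g a c"
    if t: "mono_on {..m} t" "t ` {..m} \<subseteq> {a..b}" and s: "mono_on {..n} s" "s ` {..n} \<subseteq> {b..c}"
    for m n :: nat and t s :: "nat \<Rightarrow> real"
  proof -
    \<comment> \<open>The last vertex of \<open>t\<close> and the first vertex of \<open>s\<close>
      are both kept, which gives \<open>Suc m + n\<close> edges. The edge joining them has
      nonnegative length and is dropped at the end.\<close>
    define u where "u i = (if i \<le> m then t i else s (i - Suc m))" for i
    have t_b: "a \<le> t i" "t i \<le> b" if "i \<le> m" for i using t that by auto
    have s_b: "b \<le> s i" "s i \<le> c" if "i \<le> n" for i using s that by auto
    have "mono_on {..Suc m + n} u"
    proof (rule mono_onI)
      fix i j assume ij: "i \<in> {..Suc m + n}" "j \<in> {..Suc m + n}" "i \<le> j"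
      consider "j \<le> m" | "i \<le> m" "j > m" | "i > m" using ij by linarith
      then show "u i \<le> u j"
      proof cases
        case 1 then show ?thesis using ij t(1) by (auto simp: u_def mono_on_def)
      next
        case 2 then show ?thesis using ij order_trans[OF t_b(2)[of i] s_b(1)[of "j - Suc m"]] by (auto simp: u_def)
      next
        case 3 then show ?thesis using ij mono_onD[OF s(1), of "i - Suc m" "j - Suc m"] by (auto simp: u_def)
      qed
    qed
    moreover have "u ` {..Suc m + n} \<subseteq> {a..c}"
    proof (rule image_subsetI)
      fix i assume "i \<in> {..Suc m + n}"
      then have "i \<le> m \<or> \<not> i \<le> m \<and> i - Suc m \<le> n" by auto
      then show "u i \<in> {a..c}"
      proof
        assume "i \<le> m"
        then show ?thesis using t_b[of i] assms by (simp add: u_def)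
      next
        assume "\<not> i \<le> m \<and> i - Suc m \<le> n"
        then show ?thesis using s_b[of "i - Suc m"] assms by (simp add: u_def)
      qed
    qed
    ultimately have "(\<Sum>i<Suc m + n. ennreal (dist (g (u i)) (g (u (Suc i))))) \<le> curve_length g a c"
      by (rule chain_le_curve_length)
    moreover have "(\<Sum>i<Suc m + n. ennreal (dist (g (u i)) (g (u (Suc i))))) =
      (\<Sum>i<m. ennreal (dist (g (t i)) (g (t (Suc i))))) + ennreal (dist (g (t m)) (g (s 0))) +
      (\<Sum>i<n. ennreal (dist (g (s i)) (g (s (Suc i)))))"
      unfolding sum_split by (simp add: u_def)
    ultimately show ?thesis
      by (metis (no_types, lifting) add.assoc add.commute le_iff_add order_trans)
  qed
  have right: "(\<Sum>i<m. ennreal (dist (g (t i)) (g (t (Suc i))))) + curve_length g b c \<le> curve_length g a c"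
    if t: "mono_on {..m} t" "t ` {..m} \<subseteq> {a..b}" for m t
  proof -
    \<comment> \<open>The one-vertex chain shows that the supremum ranges over a nonempty set, as
      required for moving a summand into it.\<close>
    have "(0, \<lambda>_. b) \<in> {(m::nat, t::nat \<Rightarrow> real). mono_on {..m} t \<and> t ` {..m} \<subseteq> {b..c}}"
      using assms by (auto simp: mono_on_def)
    then show ?thesis
      unfolding curve_length_def[of g b c] using cat[OF t]
      by (subst ennreal_SUP_add_right) (blast, auto intro!: SUP_least)
  qed
  have "(0, \<lambda>_. a) \<in> {(m::nat, t::nat \<Rightarrow> real). mono_on {..m} t \<and> t ` {..m} \<subseteq> {a..b}}"
    using assms by (auto simp: mono_on_def)
  then show "curve_length g a b + curve_length g b c \<le> curve_length g a c"
    unfolding curve_length_def[of g a b] using right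
    by (subst ennreal_SUP_add_left[symmetric]) (blast, auto intro!: SUP_least)
qed

text \<open>A monotone map sends chains to chains. Equality can fail if \<open>\<psi>\<close> jumps.
  Applied to a monotone bijection and again to its inverse, the inequality shows that length is
  invariant under reparametrisation.\<close>

lemma curve_length_comp_le:
  assumes "mono_on {a..b} \<psi>" "a \<le> b"
  shows "curve_length (g \<circ> \<psi>) a b \<le> curve_length g (\<psi> a) (\<psi> b)"
proof (rule curve_length_leI)
  fix m :: nat and t :: "nat \<Rightarrow> real"
  assume t: "mono_on {..m} t" "t ` {..m} \<subseteq> {a..b}"
  have "mono_on {..m} (\<psi> \<circ> t)"
  proof (rule mono_onI)
    fix i j assume "i \<in> {..m}" "j \<in> {..m}" "i \<le> j"
    then show "(\<psi> \<circ> t) i \<le> (\<psi> \<circ> t) j"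
      using mono_onD[OF assms(1), of "t i" "t j"] mono_onD[OF t(1), of i j] t(2)
      by (simp add: image_subset_iff)
  qed
  moreover have "(\<psi> \<circ> t) ` {..m} \<subseteq> {\<psi> a..\<psi> b}"
  proof (rule image_subsetI)
    fix i assume "i \<in> {..m}"
    then have "t i \<in> {a..b}" using t(2) by blast
    then show "(\<psi> \<circ> t) i \<in> {\<psi> a..\<psi> b}"
      using mono_onD[OF assms(1), of a "t i"] mono_onD[OF assms(1), of "t i" b] assms(2) by simp
  qed
  ultimately show "(\<Sum>i<m. ennreal (dist ((g \<circ> \<psi>) (t i)) ((g \<circ> \<psi>) (t (Suc i))))) \<le> curve_length g (\<psi> a) (\<psi> b)"
    using chain_le_curve_length[of m "\<psi> \<circ> t"] by auto
qed

lemma curve_length_cong: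
  assumes "\<And>x. x \<in> {a..b} \<Longrightarrow> f x = g x"
  shows "curve_length f a b = curve_length g a b"
  unfolding curve_length_def
proof (intro SUP_cong refl, clarify intro!: sum.cong refl)
  fix m :: nat and t :: "nat \<Rightarrow> real"
  assume t: "t ` {..m} \<subseteq> {a..b}"
  show "(\<Sum>i<m. ennreal (dist (f (t i)) (f (t (Suc i))))) = (\<Sum>i<m. ennreal (dist (g (t i)) (g (t (Suc i)))))"
  proof (intro sum.cong refl)
    fix i assume "i \<in> {..<m}"
    then have "t i \<in> {a..b}" "t (Suc i) \<in> {a..b}" using t by (auto simp: image_subset_iff)
    then show "ennreal (dist (f (t i)) (f (t (Suc i)))) = ennreal (dist (g (t i)) (g (t (Suc i))))"
      using assms by simp
  qed
qed

text \<open>The Lipschitz bound makes the length \<open>c\<close> of the initial piece finite and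
  continuous, and injectivity makes it strictly increasing. The loop is \<open>\<gamma>\<close>
  composed with the inverse of \<open>c\<close>.\<close>

lemma ex_arclength_loop_lipschitz:
  fixes \<gamma> :: "real \<Rightarrow> 'a::metric_space"
  assumes "a < b" and lip: "C-lipschitz_on {a..b} \<gamma>"
    and inj: "inj_on \<gamma> {a..<b}" and closed: "\<gamma> a = \<gamma> b"
  shows "\<exists>L g. arclength_loop L g (\<gamma> ` {a..b})"
proof -
  define c where "c x = enn2real (curve_length \<gamma> a x)" for x
  have len_le: "curve_length \<gamma> x y \<le> ennreal (C * (y - x))" if "a \<le> x" "x \<le> y" "y \<le> b" for x y
    using that by (intro curve_length_le_lipschitz lipschitz_on_subset[OF lip]) auto
  have fin: "curve_length \<gamma> x y < \<top>" if "a \<le> x" "x \<le> y" "y \<le> b" for x y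
    using len_le[OF that] ennreal_less_top order_le_less_trans by blast
  have len: "curve_length \<gamma> x y = ennreal (c y - c x)" "c x \<le> c y" if "a \<le> x" "x \<le> y" "y \<le> b" for x y
  proof -
    have "c y = c x + enn2real (curve_length \<gamma> x y)"
      using that fin[of a x] fin[of x y] unfolding c_def
      by (subst curve_length_add[of a x y]) (auto simp: enn2real_plus)
    then show "curve_length \<gamma> x y = ennreal (c y - c x)" "c x \<le> c y"
      using fin[of x y] that by auto
  qed
  have C: "0 \<le> C" using lip by (rule lipschitz_on_nonneg)
  have c_lip: "C-lipschitz_on {a..b} c"
  proof (rule lipschitz_on_leI)
    fix x y assume "x \<in> {a..b}" "y \<in> {a..b}" "x \<le> y"
    then show "dist (c x) (c y) \<le> C * dist x y"
      using len[of x y] len_le[of x y] C by (auto simp: dist_real_def)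
  qed (rule C)
  have c_less: "c x < c y" if "a \<le> x" "x < y" "y \<le> b" for x y
  proof -
    \<comment> \<open>Since \<open>\<gamma> a = \<gamma> b\<close>, comparing the endpoints directly
      would fail for \<open>x = a\<close>, \<open>y = b\<close>. The midpoint stays inside
      \<open>{a..<b}\<close>, where \<open>\<gamma>\<close> is injective.\<close>
    let ?m = "(x + y) / 2"
    have "\<gamma> x \<noteq> \<gamma> ?m" using that inj by (auto dest: inj_onD)
    moreover have "ennreal (dist (\<gamma> x) (\<gamma> ?m)) \<le> ennreal (c ?m - c x)"
      using dist_le_curve_length[of x ?m \<gamma>] len(1)[of x ?m] that by auto
    ultimately have "c x < c ?m"
      using len(2)[of x ?m] that by (auto simp: ennreal_le_iff2 dist_real_def)
        (smt (verit) zero_less_dist_iff)+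
    also have "c ?m \<le> c y" using len(2)[of ?m y] that by auto
    finally show ?thesis .
  qed
  have c_inj: "inj_on c {a..b}"
    by (rule inj_onI) (metis atLeastAtMost_iff c_less less_irrefl linorder_neqE_linordered_idom)
  define L where "L = c b"
  have ca: "c a = 0"
    using len_le[of a a] \<open>a < b\<close> by (simp add: c_def)
  have cont: "continuous_on {a..b} c" by (rule lipschitz_on_continuous_on[OF c_lip])
  have img: "c ` {a..b} = {0..L}"
  proof
    show "c ` {a..b} \<subseteq> {0..L}" using len(2)[of a] len(2)[of _ b] ca by (auto simp: L_def)
    show "{0..L} \<subseteq> c ` {a..b}"
      using IVT'[of c a _ b] cont ca \<open>a < b\<close> by (fastforce simp: L_def)
  qed
  define \<psi> where "\<psi> = the_inv_into {a..b} c"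
  have \<psi>: "\<psi> y \<in> {a..b}" "c (\<psi> y) = y" if "y \<in> {0..L}" for y
    using the_inv_into_into[OF c_inj _ order_refl, of y] f_the_inv_into_f[OF c_inj, of y] that img
    by (auto simp: \<psi>_def)
  have \<psi>c: "\<psi> (c x) = x" if "x \<in> {a..b}" for x
    using that the_inv_into_f_f[OF c_inj] by (auto simp: \<psi>_def)
  have \<psi>_cont: "continuous_on {0..L} \<psi>"
    using continuous_on_inv[OF cont compact_Icc, of \<psi>] \<psi>c img by auto
  have \<psi>_mono: "\<psi> x \<le> \<psi> y" if "x \<in> {0..L}" "y \<in> {0..L}" "x \<le> y" for x y
    using that \<psi>[of x] \<psi>[of y] c_less[of "\<psi> y" "\<psi> x"] by force
  have \<psi>_img: "\<psi> ` {0..L} = {a..b}"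
    using \<psi>(1) \<psi>c img by (metis (no_types, lifting) image_eqI image_subsetI subset_antisym subsetI)
  have L: "L > 0" using c_less[of a b] \<open>a < b\<close> ca by (simp add: L_def)
  have "arclength_loop L (\<gamma> \<circ> \<psi>) (\<gamma> ` {a..b})"
    unfolding arclength_loop_def
  proof (intro conjI allI impI)
    show "0 < L" by fact
    show "continuous_on {0..L} (\<gamma> \<circ> \<psi>)"
      by (rule continuous_on_compose[OF \<psi>_cont]) (simp add: \<psi>_img lipschitz_on_continuous_on[OF lip])
    show "(\<gamma> \<circ> \<psi>) L = (\<gamma> \<circ> \<psi>) 0"
      using \<psi>c[of a] \<psi>c[of b] \<open>a < b\<close> ca closed by (simp add: L_def)
    show "(\<gamma> \<circ> \<psi>) ` {0..L} = \<gamma> ` {a..b}" by (simp only: image_comp[symmetric] \<psi>_img)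
    show "inj_on (\<gamma> \<circ> \<psi>) {0..<L}"
    proof (rule inj_onI)
      fix x y assume xy: "x \<in> {0..<L}" "y \<in> {0..<L}" "(\<gamma> \<circ> \<psi>) x = (\<gamma> \<circ> \<psi>) y"
      have lt: "\<psi> z \<in> {a..<b}" if "z \<in> {0..<L}" for z
        using \<psi>[of z] that by (cases "\<psi> z = b") (auto simp: L_def)
      have "\<psi> x = \<psi> y" using inj lt[OF xy(1)] lt[OF xy(2)] xy(3) by (auto dest: inj_onD)
      then show "x = y" using \<psi>(2) xy(1,2) by (metis atLeastAtMost_iff atLeastLessThan_iff less_imp_le)
    qed
    fix x y assume xy: "0 \<le> x \<and> x \<le> y \<and> y \<le> L"
    have in_ab: "\<psi> x \<in> {a..b}" "\<psi> y \<in> {a..b}" "\<psi> x \<le> \<psi> y"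
      using xy \<psi>(1)[of x] \<psi>(1)[of y] \<psi>_mono[of x y] by auto
    have "curve_length (\<gamma> \<circ> \<psi>) x y \<le> curve_length \<gamma> (\<psi> x) (\<psi> y)"
      using xy \<psi>_mono by (intro curve_length_comp_le) (auto intro!: mono_onI)
    moreover have "curve_length ((\<gamma> \<circ> \<psi>) \<circ> c) (\<psi> x) (\<psi> y) \<le> curve_length (\<gamma> \<circ> \<psi>) (c (\<psi> x)) (c (\<psi> y))"
      using in_ab len(2) by (intro curve_length_comp_le) (auto intro!: mono_onI)
    moreover have "curve_length ((\<gamma> \<circ> \<psi>) \<circ> c) (\<psi> x) (\<psi> y) = curve_length \<gamma> (\<psi> x) (\<psi> y)"
      using in_ab \<psi>c by (intro curve_length_cong) auto
    ultimately have "curve_length (\<gamma> \<circ> \<psi>) x y = curve_length \<gamma> (\<psi> x) (\<psi> y)"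
      using \<psi>(2)[of x] \<psi>(2)[of y] xy by auto
    also have "\<dots> = ennreal (y - x)"
      using len(1)[of "\<psi> x" "\<psi> y"] in_ab \<psi>(2)[of x] \<psi>(2)[of y] xy by auto
    finally show "curve_length (\<gamma> \<circ> \<psi>) x y = ennreal (y - x)" .
  qed
  then show ?thesis by blast
qed

section \<open>The boundary of a planar convex body as an arc-length loop\<close>

lemma convex_shrink_interior:
  fixes K :: "'a::euclidean_space set"
  assumes "convex K" "p \<in> interior K" "x \<in> K" "0 \<le> c" "c < 1"
  shows "p + c *\<^sub>R (x - p) \<in> interior K"
proof -
  have "x - (1 - c) *\<^sub>R (x - p) \<in> interior K"
    using assms by (intro mem_interior_convex_shrink) auto
  then show ?thesis by (simp add: algebra_simps)
qed

text \<open>The numbers \<open>1 / a\<close> and \<open>1 / b\<close> are the values at \<open>u\<close> and \<open>v\<close> of the Minkowski gauge of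
  \<open>K\<close> centred at \<open>p\<close>.\<close>

lemma radial_lipschitz:
  fixes K :: "'a::euclidean_space set"
  assumes K: "convex K" "closed K" and p: "p \<in> interior K"
    and r: "0 < r" "cball p r \<subseteq> K"
    and ab: "0 < a" "p + a *\<^sub>R u \<in> frontier K" "0 < b" "p + b *\<^sub>R v \<in> frontier K"
  shows "1 / a \<le> 1 / b + norm (u - v) / r"
proof (rule ccontr)
  define s where "s = 1 / b + norm (u - v) / r"
  assume "\<not> ?thesis"
  then have less: "s < 1 / a" by (simp add: s_def)
  have s: "0 < s" using ab r by (simp add: s_def add_pos_nonneg)
  \<comment> \<open>This is the point of the sphere of radius \<open>r\<close> about
    \<open>p\<close> in the direction \<open>u - v\<close>; for \<open>u = v\<close>, division by
    zero makes it \<open>p\<close>. The point \<open>p + (1 / s) *\<^sub>R u\<close> is a convex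
    combination of \<open>p + b *\<^sub>R v\<close> and \<open>w\<close>, hence lies in
    \<open>K\<close>. If \<open>s < 1 / a\<close>, then \<open>p + a *\<^sub>R u\<close> lies
    strictly between it and \<open>p\<close>, so it would be interior.\<close>
  define w where "w = p + (r / norm (u - v)) *\<^sub>R (u - v)"
  have w: "w \<in> K"
    using r by (intro subsetD[OF r(2)]) (cases "u = v", auto simp: w_def dist_norm)
  have v: "p + b *\<^sub>R v \<in> K" using ab K(2) by (auto simp: frontier_def)
  have "(1 / b / s) *\<^sub>R (p + b *\<^sub>R v) + (norm (u - v) / r / s) *\<^sub>R w \<in> K"
  proof (rule convexD[OF K(1) v w])
    have "1 / b / s + norm (u - v) / r / s = s / s"
      unfolding s_def by (simp only: add_divide_distrib)
    then show "1 / b / s + norm (u - v) / r / s = 1" using s by simp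
  qed (use s ab r in auto)
  also have "(1 / b / s) *\<^sub>R (p + b *\<^sub>R v) + (norm (u - v) / r / s) *\<^sub>R w
      = ((1 / b + norm (u - v) / r) / s) *\<^sub>R p + (1 / s) *\<^sub>R (v + (norm (u - v) / r * (r / norm (u - v))) *\<^sub>R (u - v))"
    using ab by (simp add: w_def scaleR_add_right scaleR_add_left add_divide_distrib algebra_simps)
  also have "\<dots> = p + (1 / s) *\<^sub>R u"
    using s r unfolding s_def[symmetric] by (cases "u = v") auto
  finally have "p + (1 / s) *\<^sub>R u \<in> K" .
  then have "p + (a * s) *\<^sub>R (p + (1 / s) *\<^sub>R u - p) \<in> interior K"
    using less ab s by (intro convex_shrink_interior K p) (auto simp: field_simps)
  then have "p + a *\<^sub>R u \<in> interior K" using s by simp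
  then show False using ab by (simp add: frontier_def)
qed

text \<open>The radial distance \<open>k\<close> is the reciprocal of the gauge of \<open>K\<close>
  at the unit vectors \<open>e \<theta>\<close>. The gauge is Lipschitz with constant
  \<open>1 / r\<close> for an inscribed radius \<open>r\<close>, and \<open>k\<close> is bounded by
  \<open>R\<close>, so taking reciprocals keeps the Lipschitz property.\<close>

lemma ex_arclength_loop_frontier:
  fixes K :: "(real ^ 2) set"
  assumes "convex_body K"
  shows "\<exists>L g. arclength_loop L g (frontier K)"
proof -
  have K: "convex K" "compact K" "closed K" "bounded K"
    using assms by (auto simp: convex_body_def compact_imp_closed compact_imp_bounded)
  obtain p where p: "p \<in> interior K" using assms by (auto simp: convex_body_def)
  obtain r where r: "0 < r" "cball p r \<subseteq> K" using p by (auto simp: mem_interior_cball)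
  obtain R where R: "0 < R" "\<And>x. x \<in> K \<Longrightarrow> dist p x \<le> R"
    using bounded_any_center[of K p] K(4) by (metis bounded_pos dual_order.trans gt_ex less_eq_real_def linorder_not_less)
  define e :: "real \<Rightarrow> real ^ 2" where "e \<theta> = vector [cos \<theta>, sin \<theta>]" for \<theta>
  have norm_e: "norm (e \<theta>) = 1" for \<theta>
    by (simp add: e_def norm_vec_def L2_set_def sum_2)
  have e_lip: "norm (e x - e y) \<le> 2 * \<bar>x - y\<bar>" for x y
  proof -
    have "norm (e x - e y) \<le> \<bar>cos x - cos y\<bar> + \<bar>sin x - sin y\<bar>"
      using norm_le_l1_cart[of "e x - e y"] by (simp add: e_def sum_2)
    also have "\<bar>cos x - cos y\<bar> \<le> \<bar>x - y\<bar>"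
      using field_differentiable_bound[of UNIV cos "\<lambda>x. - sin x" 1 y x]
      by (auto intro!: derivative_eq_intros)
    also have "\<bar>sin x - sin y\<bar> \<le> \<bar>x - y\<bar>"
      using field_differentiable_bound[of UNIV sin cos 1 y x]
      by (auto intro!: derivative_eq_intros)
    finally show ?thesis by simp
  qed
  have "\<exists>k. 0 < k \<and> p + k *\<^sub>R e \<theta> \<in> frontier K" for \<theta>
  proof -
    have "e \<theta> \<noteq> 0" using norm_e[of \<theta>] by auto
    then show ?thesis using ray_to_frontier[OF K(4) p] by metis
  qed
  then obtain k where k: "\<And>\<theta>. 0 < k \<theta>" "\<And>\<theta>. p + k \<theta> *\<^sub>R e \<theta> \<in> frontier K" by metis
  have frontier_K: "frontier K \<subseteq> K" using K(3) by (rule frontier_subset_closed)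
  have kR: "k \<theta> \<le> R" for \<theta>
    using R(2)[of "p + k \<theta> *\<^sub>R e \<theta>"] k(1)[of \<theta>] k(2)[of \<theta>] frontier_K norm_e[of \<theta>] by (auto simp: dist_norm)
  define \<gamma> where "\<gamma> \<theta> = p + k \<theta> *\<^sub>R e \<theta>" for \<theta>
  have k_lip: "k x - k y \<le> R\<^sup>2 / r * norm (e x - e y)" for x y
  proof -
    have "1 / k y \<le> 1 / k x + norm (e x - e y) / r"
      using radial_lipschitz[OF K(1,3) p r k(1) k(2) k(1) k(2), of y x] by (simp add: norm_minus_commute)
    \<comment> \<open>The gauge bound is multiplied by \<open>k x * k y\<close>, which is at most
      \<open>R\<^sup>2\<close>.\<close>
    then have "k x - k y \<le> (k x * k y) * (norm (e x - e y) / r)"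
      using k(1)[of x] k(1)[of y] by (simp add: field_simps)
    also have "\<dots> \<le> R\<^sup>2 * (norm (e x - e y) / r)"
      unfolding power2_eq_square
      by (intro mult_right_mono mult_mono) (use kR[of x] kR[of y] k(1)[of x] k(1)[of y] R(1) r(1) in auto)
    finally show ?thesis by simp
  qed
  \<comment> \<open>The two summands bound the change of the radius and the change of the direction;
    the factor 2 comes from \<open>e_lip\<close>.\<close>
  define C where "C = 2 * (R\<^sup>2 / r + R)"
  have "C-lipschitz_on {0..2 * pi} \<gamma>"
  proof (rule lipschitz_onI)
    fix x y :: real
    have "\<gamma> x - \<gamma> y = (k x - k y) *\<^sub>R e x + k y *\<^sub>R (e x - e y)"
      by (simp add: \<gamma>_def algebra_simps)
    then have "dist (\<gamma> x) (\<gamma> y) \<le> \<bar>k x - k y\<bar> + k y * norm (e x - e y)"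
      using norm_triangle_ineq[of "(k x - k y) *\<^sub>R e x" "k y *\<^sub>R (e x - e y)"] norm_e k(1)[of y]
      by (simp add: dist_norm)
    also have "\<bar>k x - k y\<bar> \<le> R\<^sup>2 / r * norm (e x - e y)"
      using k_lip[of x y] k_lip[of y x] by (simp add: norm_minus_commute abs_le_iff)
    also have "k y * norm (e x - e y) \<le> R * norm (e x - e y)"
      using kR by (simp add: mult_right_mono)
    also have "R\<^sup>2 / r * norm (e x - e y) + R * norm (e x - e y) = (R\<^sup>2 / r + R) * norm (e x - e y)"
      by (simp add: algebra_simps)
    also have "\<dots> \<le> (R\<^sup>2 / r + R) * (2 * \<bar>x - y\<bar>)"
      using R(1) r(1) by (intro mult_left_mono e_lip) auto
    finally show "dist (\<gamma> x) (\<gamma> y) \<le> C * dist x y"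
      unfolding C_def dist_real_def by (simp only: mult_ac)
  next
    show "0 \<le> C" using R(1) r(1) by (simp add: C_def)
  qed
  moreover have "inj_on \<gamma> {0..<2 * pi}"
  proof (rule inj_onI)
    fix x y assume xy: "x \<in> {0..<2 * pi}" "y \<in> {0..<2 * pi}" "\<gamma> x = \<gamma> y"
    then have eq: "k x *\<^sub>R e x = k y *\<^sub>R e y" by (simp add: \<gamma>_def)
    then have "norm (k x *\<^sub>R e x) = norm (k y *\<^sub>R e y)" by simp
    then have "k x = k y" using norm_e k(1)[of x] k(1)[of y] by simp
    with eq k(1)[of y] have "e x = e y" by simp
    then have "e x $ 1 = e y $ 1" "e x $ 2 = e y $ 2" by simp_all
    then obtain j :: int where j: "x = y + 2 * pi * j"
      using sin_cos_eq_iff[of x y] by (auto simp: e_def)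
    have "2 * pi * real_of_int j < 2 * pi" "- (2 * pi) < 2 * pi * real_of_int j"
      using xy(1,2) j unfolding atLeastLessThan_iff by linarith+
    moreover have "2 * pi * real_of_int j \<ge> 2 * pi * 1" if "1 \<le> j"
      using that by (intro mult_left_mono) auto
    moreover have "2 * pi * real_of_int j \<le> 2 * pi * (- 1)" if "j \<le> - 1"
      using that by (intro mult_left_mono) auto
    ultimately have "j = 0" by force
    then show "x = y" using j by simp
  qed
  moreover have "\<gamma> 0 = \<gamma> (2 * pi)"
  proof -
    have "e 0 = e (2 * pi)" by (simp add: e_def)
    \<comment> \<open>The radii were chosen separately for each angle, so periodicity is not built
      in. It follows from \<open>k_lip\<close>, because the two directions agree.\<close>
    moreover have "k 0 = k (2 * pi)"
      using k_lip[of 0 "2 * pi"] k_lip[of "2 * pi" 0] calculation by simp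
    ultimately show ?thesis by (simp add: \<gamma>_def)
  qed
  moreover have "\<gamma> ` {0..2 * pi} = frontier K"
  proof
    show "\<gamma> ` {0..2 * pi} \<subseteq> frontier K" using k by (auto simp: \<gamma>_def)
    show "frontier K \<subseteq> \<gamma> ` {0..2 * pi}"
    proof
      fix x assume x: "x \<in> frontier K"
      define d where "d = norm (x - p)"
      have d: "0 < d" using x p by (auto simp: d_def frontier_def)
      have "((x - p) $ 1 / d)\<^sup>2 + ((x - p) $ 2 / d)\<^sup>2 = 1"
      proof -
        have "((x - p) $ 1)\<^sup>2 + ((x - p) $ 2)\<^sup>2 = d\<^sup>2"
          by (simp add: d_def norm_vec_def L2_set_def sum_2)
        then show ?thesis using d by (simp add: power_divide add_divide_distrib[symmetric])
      qed
      then obtain \<theta> where \<theta>: "0 \<le> \<theta>" "\<theta> < 2 * pi" "(x - p) $ 1 / d = cos \<theta>" "(x - p) $ 2 / d = sin \<theta>"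
        by (rule sincos_total_2pi)
      then have "x - p = d *\<^sub>R e \<theta>" using d by (simp add: vec_eq_iff forall_2 e_def field_simps)
      then have x_eq: "x = p + d *\<^sub>R e \<theta>" by (simp add: algebra_simps)
      have xf: "p + d *\<^sub>R e \<theta> \<in> frontier K" using x x_eq by simp
      \<comment> \<open>With equal directions \<open>radial_lipschitz\<close> holds both ways, so a
        ray from \<open>p\<close> meets the frontier only once.\<close>
      have "1 / d = 1 / k \<theta>"
        using radial_lipschitz[OF K(1,3) p r d xf k(1) k(2)] radial_lipschitz[OF K(1,3) p r k(1) k(2) d xf]
        by (metis antisym diff_self norm_zero div_0 add.right_neutral)
      then have "x = \<gamma> \<theta>" using x_eq d k(1)[of \<theta>] by (simp add: \<gamma>_def)
      then show "x \<in> \<gamma> ` {0..2 * pi}" using \<theta> by auto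
    qed
  qed
  ultimately show ?thesis
    using ex_arclength_loop_lipschitz[of 0 "2 * pi" C \<gamma>] by auto
qed

section \<open>Integrals over thin sectors\<close>

lemma lborel_integral_affine:
  fixes f :: "'a::euclidean_space \<Rightarrow> real"
  assumes [measurable]: "f \<in> borel_measurable borel" and "c \<noteq> 0"
  shows "(\<integral>x. f x \<partial>lborel) = \<bar>c\<bar> ^ DIM('a) * (\<integral>x. f (t + c *\<^sub>R x) \<partial>lborel)"
  by (subst lborel_affine[OF \<open>c \<noteq> 0\<close>, of t])
    (simp add: integral_density integral_distr)

text \<open>The set minus its \<open>c\<close>-dilate has measure \<open>(1 - c ^ d) * |S|\<close> and carries the fraction
  \<open>1 - c powr (n + d)\<close> of the integral, where \<open>d\<close> is the dimension; compare derivatives at \<open>c = 1\<close>.\<close>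

lemma star_shaped_integral_dist_powr_le:
  fixes S :: "'a::euclidean_space set" and n :: real
  assumes S: "compact S" and star: "\<And>x c. x \<in> S \<Longrightarrow> 0 \<le> c \<Longrightarrow> c \<le> 1 \<Longrightarrow> p + c *\<^sub>R (x - p) \<in> S"
    and \<rho>: "\<And>x. x \<in> S \<Longrightarrow> dist x p \<le> \<rho>" and n: "0 < n"
  shows "(\<integral>x. indicator S x * dist x p powr n \<partial>lborel)
    \<le> DIM('a) / (n + DIM('a)) * measure lborel S * \<rho> powr n"
proof -
  define T where "T c = (\<lambda>x. p + c *\<^sub>R (x - p)) ` S" for c :: real
  have T: "compact (T c)" for c
    unfolding T_def by (intro compact_continuous_image S continuous_intros)
  have int: "integrable lborel (\<lambda>x. indicator A x * dist x p powr n)" if "compact A" for A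
  proof -
    have "continuous_on A (\<lambda>x. dist x p powr n)"
      using n by (intro continuous_on_powr' continuous_intros) auto
    from borel_integrable_compact[OF that this] show ?thesis by simp
  qed
  have int1: "integrable lborel (indicat_real A)" if "compact A" for A :: "'a set"
    using borel_integrable_compact[OF that, of "\<lambda>_. 1::real"] by simp
  have meas: "T c \<in> sets borel" for c using T[of c] by (simp add: borel_compact)
  define I where "I = (\<integral>x. indicator S x * dist x p powr n \<partial>lborel)"
  define m where "m = measure lborel S"
  have ineq: "I * (1 - c powr (n + DIM('a))) \<le> \<rho> powr n * m * (1 - c powr DIM('a))" if c: "0 < c" "c < 1" for c
  proof -
    have ind: "indicat_real (T c) (p - c *\<^sub>R p + c *\<^sub>R x) = indicat_real S x" for x
    proof -
      have "p - c *\<^sub>R p + c *\<^sub>R x \<in> T c \<longleftrightarrow> x \<in> S"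
      proof
        assume "p - c *\<^sub>R p + c *\<^sub>R x \<in> T c"
        then obtain y where "y \<in> S" "c *\<^sub>R x = c *\<^sub>R y" by (auto simp: T_def algebra_simps)
        then show "x \<in> S" using c by simp
      qed (auto simp: T_def algebra_simps)
      then show ?thesis by (simp add: indicator_def)
    qed
    have d: "dist (p - c *\<^sub>R p + c *\<^sub>R x) p = c * dist x p" for x
    proof -
      have "p - c *\<^sub>R p + c *\<^sub>R x - p = c *\<^sub>R (x - p)" by (simp add: algebra_simps)
      then show ?thesis using c by (simp add: dist_norm)
    qed
    \<comment> \<open>The substitution is the dilation about \<open>p\<close> by the factor
      \<open>c\<close>, written as a translation by \<open>p - c *\<^sub>R p\<close> after a
      scaling.\<close>
    have "(\<integral>x. indicator (T c) x * dist x p powr n \<partial>lborel)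
       = \<bar>c\<bar> ^ DIM('a) * (\<integral>x. indicator (T c) (p - c *\<^sub>R p + c *\<^sub>R x) * dist (p - c *\<^sub>R p + c *\<^sub>R x) p powr n \<partial>lborel)"
      using meas c by (intro lborel_integral_affine) auto
    also have "\<dots> = c powr DIM('a) * (\<integral>x. c powr n * (indicator S x * dist x p powr n) \<partial>lborel)"
      unfolding ind d using c by (simp add: powr_mult powr_realpow mult_ac)
    finally have I_T: "(\<integral>x. indicator (T c) x * dist x p powr n \<partial>lborel) = c powr (n + DIM('a)) * I"
      by (simp add: I_def powr_add)
    have "(\<integral>x. indicator (T c) x \<partial>lborel)
       = \<bar>c\<bar> ^ DIM('a) * (\<integral>x. indicat_real (T c) (p - c *\<^sub>R p + c *\<^sub>R x) \<partial>lborel)"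
      using meas c by (intro lborel_integral_affine) auto
    then have m_T: "measure lborel (T c) = c powr DIM('a) * m"
      unfolding ind m_def using c S meas by (simp add: powr_realpow borel_compact)
    have TS: "T c \<subseteq> S" using star c by (auto simp: T_def)
    have "(\<integral>x. indicator S x * dist x p powr n - indicator (T c) x * dist x p powr n \<partial>lborel)
      \<le> (\<integral>x. \<rho> powr n * (indicator S x - indicator (T c) x) \<partial>lborel)"
    proof (rule integral_mono)
      fix x
      show "indicator S x * dist x p powr n - indicator (T c) x * dist x p powr n \<le> \<rho> powr n * (indicator S x - indicator (T c) x)"
        using TS \<rho>[of x] n by (cases "x \<in> S"; cases "x \<in> T c") (auto intro!: powr_mono2)
    qed (use int int1 S T in auto)
    then show ?thesis
      using int[OF S] int[OF T[of c]] int1[OF S] int1[OF T[of c]] S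
      by (simp add: I_T m_T I_def[symmetric] m_def[symmetric] borel_compact) (simp add: algebra_simps)
  qed
  \<comment> \<open>By \<open>ineq\<close>, \<open>h\<close> is nonnegative on (0, 1), and it
    vanishes at 1. Its derivative at 1 therefore cannot be positive, which is the claimed bound on
    \<open>I\<close>.\<close>
  define h where "h c = \<rho> powr n * m * (1 - c powr DIM('a)) - I * (1 - c powr (n + DIM('a)))" for c
  have "(h has_real_derivative (\<rho> powr n * m * (- DIM('a)) - I * (- (n + DIM('a))))) (at 1)"
    unfolding h_def by (auto intro!: derivative_eq_intros)
  moreover have "h 1 = 0" by (simp add: h_def)
  ultimately have "\<not> 0 < \<rho> powr n * m * (- DIM('a)) - I * (- (n + DIM('a)))"
  proof (intro notI)
    assume pos: "0 < \<rho> powr n * m * (- DIM('a)) - I * (- (n + DIM('a)))"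
      and der: "(h has_real_derivative (\<rho> powr n * m * (- DIM('a)) - I * (- (n + DIM('a))))) (at 1)"
      and h1: "h 1 = 0"
    obtain d where d: "d > 0" "\<And>e. 0 < e \<Longrightarrow> e < d \<Longrightarrow> h (1 - e) < h 1"
      using DERIV_pos_inc_left[OF der pos] by blast
    define e where "e = min d 1 / 2"
    have "h (1 - e) < 0" "0 \<le> h (1 - e)"
      using d(1) d(2)[of e] ineq[of "1 - e"] h1 by (auto simp: e_def h_def)
    then show False by simp
  qed
  then have "I * (n + DIM('a)) \<le> DIM('a) * m * \<rho> powr n" by (simp add: algebra_simps)
  then show ?thesis using n unfolding I_def m_def by (simp add: field_simps)
qed

text \<open>In the orthonormal frame with first axis from \<open>p\<close> to \<open>g a\<close>,
  all points of the arc have height between \<open>R - h\<close> and \<open>R + h\<close>, and their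
  transverse coordinates span at most \<open>h\<close>. So the slopes seen from \<open>p\<close>
  span at most \<open>h / (R - h)\<close>, and the sector lies in the triangle with apex
  \<open>p\<close> and height \<open>R + h\<close> cut out by the extreme slopes.\<close>

lemma sector_area_le:
  fixes g :: "real \<Rightarrow> real ^ 2"
  assumes "a \<le> b" and lip: "1-lipschitz_on {a..b} g" and less: "b - a < dist (g a) p"
  defines "h \<equiv> b - a" and "R \<equiv> dist (g a) p"
  defines "S \<equiv> (\<lambda>(r, t). p + r *\<^sub>R (g t - p)) ` ({0..1} \<times> {a..b})"
  shows "compact S" "measure lborel S \<le> (R + h)\<^sup>2 * h / (2 * (R - h))"
proof -
  have h: "0 \<le> h" "h < R" using assms by auto
  have cont: "continuous_on {a..b} g" by (rule lipschitz_on_continuous_on[OF lip])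
  have "continuous_on ({0..1} \<times> {a..b}) (\<lambda>x. g (snd x))"
    by (rule continuous_on_compose2[OF cont]) (auto intro: continuous_intros)
  then show S: "compact S" unfolding S_def
    by (intro compact_continuous_image compact_Times) (auto simp: case_prod_unfold intro!: continuous_intros)
  define e where "e = (1 / R) *\<^sub>R (g a - p)"
  have norm_e: "norm e = 1" using h by (auto simp: e_def R_def dist_norm)
  \<comment> \<open>This is \<open>e\<close> turned by a right angle; \<open>dec\<close> expands
    vectors in the basis \<open>e\<close>, \<open>w\<close>.\<close>
  define w :: "real ^ 2" where "w = vector [- (e $ 2), e $ 1]"
  have e12: "(e $ 1)\<^sup>2 + (e $ 2)\<^sup>2 = 1"
    using norm_e by (simp add: norm_vec_def L2_set_def sum_2)
  have norm_w: "norm w = 1"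
    using e12 by (simp add: w_def norm_vec_def L2_set_def sum_2 add.commute)
  define u v where "u t = (g t - p) \<bullet> e" and "v t = (g t - p) \<bullet> w" for t
  have dec: "x = (x \<bullet> e) *\<^sub>R e + (x \<bullet> w) *\<^sub>R w" for x
  proof -
    have "x $ 1 * ((e $ 1)\<^sup>2 + (e $ 2)\<^sup>2) = (x \<bullet> e) * e $ 1 + (x \<bullet> w) * w $ 1"
      "x $ 2 * ((e $ 1)\<^sup>2 + (e $ 2)\<^sup>2) = (x \<bullet> e) * e $ 2 + (x \<bullet> w) * w $ 2"
      by (simp_all add: inner_vec_def sum_2 w_def power2_eq_square algebra_simps)
    then show ?thesis by (simp add: vec_eq_iff forall_2 e12)
  qed
  have diff: "\<bar>u s - u t\<bar> \<le> h" "\<bar>v s - v t\<bar> \<le> h" if "s \<in> {a..b}" "t \<in> {a..b}" for s t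
  proof -
    have "norm (g s - g t) \<le> h"
      using lipschitz_onD[OF lip that] that by (auto simp: dist_norm h_def)
    moreover have "u s - u t = (g s - g t) \<bullet> e" "v s - v t = (g s - g t) \<bullet> w"
      by (auto simp: u_def v_def inner_diff_left)
    ultimately show "\<bar>u s - u t\<bar> \<le> h" "\<bar>v s - v t\<bar> \<le> h"
      using Cauchy_Schwarz_ineq2[of "g s - g t" e] Cauchy_Schwarz_ineq2[of "g s - g t" w] norm_e norm_w by auto
  qed
  have ua: "u a = R"
  proof -
    have "g a - p = R *\<^sub>R e" using h by (simp add: e_def)
    then show ?thesis using norm_e by (simp add: u_def dot_square_norm)
  qed
  have va: "v a = 0"
    by (simp add: v_def e_def w_def inner_vec_def sum_2)
  have u: "R - h \<le> u t" "u t \<le> R + h" if "t \<in> {a..b}" for t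
    using diff(1)[of t a] that ua by auto
  have "continuous_on {a..b} v" unfolding v_def by (intro continuous_intros cont)
  then obtain t0 t1 where t01: "t0 \<in> {a..b}" "t1 \<in> {a..b}"
    "\<And>t. t \<in> {a..b} \<Longrightarrow> v t0 \<le> v t" "\<And>t. t \<in> {a..b} \<Longrightarrow> v t \<le> v t1"
    using continuous_attains_inf[of "{a..b}" v] continuous_attains_sup[of "{a..b}" v] \<open>a \<le> b\<close> by auto
  have v01: "v t0 \<le> 0" "0 \<le> v t1" "v t1 - v t0 \<le> h"
    using t01(3)[of a] t01(4)[of a] va diff(2)[OF t01(2,1)] \<open>a \<le> b\<close> by auto
  \<comment> \<open>Dividing by the least height \<open>R - h\<close> gives bounds for all slopes
    \<open>v t / u t\<close>, because \<open>v t0 \<le> 0 \<le> v t1\<close>.\<close>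
  define U \<alpha> \<beta> where "U = R + h" and "\<alpha> = v t0 / (R - h)" and "\<beta> = v t1 / (R - h)"
  define A B where "A = p + U *\<^sub>R (e + \<alpha> *\<^sub>R w)" and "B = p + U *\<^sub>R (e + \<beta> *\<^sub>R w)"
  have U: "0 < U" using h by (simp add: U_def)
  have \<alpha>\<beta>: "\<beta> - \<alpha> \<le> h / (R - h)" "\<alpha> \<le> \<beta>"
    using v01 h by (auto simp: \<alpha>_def \<beta>_def diff_divide_distrib[symmetric] intro!: divide_right_mono)
  have "S \<subseteq> convex hull {p, A, B}"
  proof
    fix x assume "x \<in> S"
    then obtain r t where r: "0 \<le> r" "r \<le> 1" and t: "t \<in> {a..b}" and x: "x = p + r *\<^sub>R (g t - p)"
      by (auto simp: S_def)
    have ut: "0 < u t" "R - h \<le> u t" "u t \<le> U" using u[OF t] h by (auto simp: U_def)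
    have "v t0 / (R - h) \<le> v t0 / u t"
      using ut h v01(1) by (intro divide_left_mono_neg) (auto)
    also have "\<dots> \<le> v t / u t" using ut t01(3)[OF t] by (intro divide_right_mono) auto
    finally have 1: "\<alpha> \<le> v t / u t" by (simp add: \<alpha>_def)
    have "v t / u t \<le> v t1 / u t" using ut t01(4)[OF t] by (intro divide_right_mono) auto
    also have "\<dots> \<le> v t1 / (R - h)"
      using ut h v01(2) by (intro divide_left_mono) auto
    finally have 2: "v t / u t \<le> \<beta>" by (simp add: \<beta>_def)
    have "v t / u t \<in> closed_segment \<alpha> \<beta>"
      using 1 2 by (simp add: closed_segment_eq_real_ivl)
    then obtain \<mu> where \<mu>: "0 \<le> \<mu>" "\<mu> \<le> 1" "v t / u t = (1 - \<mu>) * \<alpha> + \<mu> * \<beta>"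
      by (auto simp: in_segment)
    have "(1 - \<mu>) *\<^sub>R A + \<mu> *\<^sub>R B = p + U *\<^sub>R (e + (v t / u t) *\<^sub>R w)"
      unfolding \<mu>(3) A_def B_def by (simp add: algebra_simps)
    moreover have "(1 - \<mu>) *\<^sub>R A + \<mu> *\<^sub>R B \<in> convex hull {p, A, B}"
      using \<mu> by (intro convexD[OF convex_convex_hull]) (auto intro: hull_inc)
    ultimately have y: "p + U *\<^sub>R (e + (v t / u t) *\<^sub>R w) \<in> convex hull {p, A, B}" by simp
    \<comment> \<open>The ray from \<open>p\<close> through \<open>x\<close> hits the side
      \<open>A B\<close> at height \<open>U\<close>, while \<open>x\<close> has height
      \<open>r * u t\<close>. The ratio locates \<open>x\<close> on the segment from
      \<open>p\<close> to that hitting point.\<close>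
    define \<kappa> where "\<kappa> = r * u t / U"
    have \<kappa>: "0 \<le> \<kappa>" "\<kappa> \<le> 1"
      using r ut U mult_mono[of r 1 "u t" U] by (auto simp: \<kappa>_def)
    have "(1 - \<kappa>) *\<^sub>R p + \<kappa> *\<^sub>R (p + U *\<^sub>R (e + (v t / u t) *\<^sub>R w)) \<in> convex hull {p, A, B}"
      using \<kappa> y by (intro convexD[OF convex_convex_hull]) (auto intro: hull_inc)
    also have "(1 - \<kappa>) *\<^sub>R p + \<kappa> *\<^sub>R (p + U *\<^sub>R (e + (v t / u t) *\<^sub>R w))
        = p + (\<kappa> * U) *\<^sub>R e + (\<kappa> * U * (v t / u t)) *\<^sub>R w"
      by (simp add: algebra_simps)
    also have "\<dots> = p + (r * u t) *\<^sub>R e + (r * v t) *\<^sub>R w"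
      using U ut by (simp add: \<kappa>_def)
    also have "\<dots> = p + r *\<^sub>R (u t *\<^sub>R e + v t *\<^sub>R w)" by (simp add: algebra_simps)
    also have "\<dots> = x" using dec[of "g t - p"] by (simp add: x u_def v_def)
    finally show "x \<in> convex hull {p, A, B}" .
  qed
  moreover have hull: "compact (convex hull {p, A, B})" by (simp add: finite_imp_compact_convex_hull)
  ultimately have "measure lborel S \<le> measure lborel (convex hull {p, A, B})"
    using S fmeasurable_compact[OF hull] by (intro measure_mono_fmeasurable) (auto simp: borel_compact)
  also have "\<dots> = \<bar>(B $ 1 - p $ 1) * (A $ 2 - p $ 2) - (A $ 1 - p $ 1) * (B $ 2 - p $ 2)\<bar> / 2"
    by (rule content_triangle)
  also have "(B $ 1 - p $ 1) * (A $ 2 - p $ 2) - (A $ 1 - p $ 1) * (B $ 2 - p $ 2)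
      = U\<^sup>2 * ((\<alpha> - \<beta>) * ((e $ 1)\<^sup>2 + (e $ 2)\<^sup>2))"
    by (simp add: A_def B_def w_def power2_eq_square algebra_simps)
  also have "\<bar>\<dots>\<bar> / 2 = U\<^sup>2 * (\<beta> - \<alpha>) / 2"
    using \<alpha>\<beta> by (simp add: e12 abs_mult)
  also have "\<dots> \<le> U\<^sup>2 * (h / (R - h)) / 2"
    using \<alpha>\<beta> by (intro divide_right_mono mult_left_mono) auto
  finally show "measure lborel S \<le> (R + h)\<^sup>2 * h / (2 * (R - h))" by (simp add: U_def algebra_simps)
qed

section \<open>Comparison of area and boundary integrals\<close>

text \<open>The star-shaped bound with radius \<open>R + h\<close> and the area bound together give
  h (R + h)^(n+2) / ((n + 2) (R - h)). This is read as the integral of a constant over the arc and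
  compared pointwise with the boundary integrand. The loss is a factor that tends to 1 with
  \<open>\<epsilon>\<close>.\<close>

lemma sector_integral_le:
  fixes g :: "real \<Rightarrow> real ^ 2"
  assumes n: "0 < n" and ab: "a \<le> b" and lip: "1-lipschitz_on {a..b} g"
    and \<delta>: "0 < \<delta>" "\<And>t. t \<in> {a..b} \<Longrightarrow> \<delta> \<le> dist (g t) p" and small: "2 * (b - a) < \<delta>"
  defines "\<epsilon> \<equiv> 2 * (b - a) / \<delta>"
  defines "S \<equiv> (\<lambda>(r, t). p + r *\<^sub>R (g t - p)) ` ({0..1} \<times> {a..b})"
  shows "(\<integral>x. indicator S x * dist x p powr n \<partial>lborel)
    \<le> (1 + \<epsilon>) powr (n + 2) / (1 - \<epsilon>) / (n + 2) * integral {a..b} (\<lambda>t. dist (g t) p powr (n + 1))"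
proof -
  define h where "h = b - a"
  define R where "R = dist (g a) p"
  have h: "0 \<le> h" "2 * h < \<delta>" using ab small by (auto simp: h_def)
  have R: "\<delta> \<le> R" using \<delta>(2)[of a] ab by (simp add: R_def)
  have less: "b - a < dist (g a) p" using h R by (simp add: h_def R_def)
  have S: "compact S" and area: "measure lborel S \<le> (R + h)\<^sup>2 * h / (2 * (R - h))"
    using sector_area_le[OF ab lip less] by (simp_all only: S_def R_def h_def)
  have dist_g: "\<bar>dist (g t) p - R\<bar> \<le> h" if t: "t \<in> {a..b}" for t
  proof -
    have "dist (g t) (g a) \<le> h"
      using lipschitz_onD[OF lip t, of a] t by (auto simp: h_def dist_real_def)
    then show ?thesis
      using dist_triangle[of "g t" p "g a"] dist_triangle[of "g a" p "g t"]
      by (auto simp: R_def abs_le_iff dist_commute)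
  qed
  have "(\<integral>x. indicator S x * dist x p powr n \<partial>lborel)
      \<le> DIM(real ^ 2) / (n + DIM(real ^ 2)) * measure lborel S * (R + h) powr n"
  proof (rule star_shaped_integral_dist_powr_le[OF S _ _ n])
    fix x and c :: real assume "x \<in> S" and c: "0 \<le> c" "c \<le> 1"
    then obtain r t where x: "r \<in> {0..1}" "t \<in> {a..b}" "x = p + r *\<^sub>R (g t - p)" by (auto simp: S_def)
    then have "c * r \<in> {0..1}" "p + c *\<^sub>R (x - p) = p + (c * r) *\<^sub>R (g t - p)"
      using c by (auto intro: mult_le_one)
    then show "p + c *\<^sub>R (x - p) \<in> S" using x(2) unfolding S_def by force
  next
    fix x assume "x \<in> S"
    then obtain r t where x: "r \<in> {0..1}" "t \<in> {a..b}" "x = p + r *\<^sub>R (g t - p)" by (auto simp: S_def)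
    then have "dist x p = r * dist (g t) p" by (simp add: dist_norm)
    also have "\<dots> \<le> 1 * dist (g t) p" using x by (intro mult_right_mono) auto
    also have "\<dots> \<le> R + h" using dist_g[OF x(2)] by auto
    finally show "dist x p \<le> R + h" .
  qed
  also have "\<dots> = 2 / (n + 2) * measure lborel S * (R + h) powr n" by simp
  also have "\<dots> \<le> 2 / (n + 2) * ((R + h)\<^sup>2 * h / (2 * (R - h))) * (R + h) powr n"
    using n area by (intro mult_right_mono mult_left_mono) auto
  also have "\<dots> = 1 / (n + 2) * (h * ((R + h) powr (n + 2) / (R - h)))"
  proof -
    have "(R + h) powr (n + 2) = (R + h)\<^sup>2 * (R + h) powr n"
      using h R \<delta>(1) by (simp add: powr_add)
    moreover have "2 / k * (X * h / (2 * D)) * P = 1 / k * (h * (X * P / D))" for k X D P :: real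
      by (cases "k = 0"; cases "D = 0") (simp_all add: field_simps)
    ultimately show ?thesis by metis
  qed
  also have "h * ((R + h) powr (n + 2) / (R - h)) = integral {a..b} (\<lambda>t. (R + h) powr (n + 2) / (R - h))"
    using ab by (simp add: h_def)
  also have "\<dots> \<le> integral {a..b} (\<lambda>t. (1 + \<epsilon>) powr (n + 2) / (1 - \<epsilon>) * dist (g t) p powr (n + 1))"
  proof (rule integral_le)
    show "(\<lambda>t. (1 + \<epsilon>) powr (n + 2) / (1 - \<epsilon>) * dist (g t) p powr (n + 1)) integrable_on {a..b}"
      using n by (intro integrable_continuous_real continuous_intros continuous_on_powr' lipschitz_on_continuous_on[OF lip]) auto
    fix t assume t: "t \<in> {a..b}"
    define r where "r = dist (g t) p"
    have r: "\<delta> \<le> r" using \<delta>(2)[OF t] by (simp add: r_def)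
    \<comment> \<open>Both \<open>R + h\<close> and \<open>R - h\<close> differ from
      \<open>r\<close> by at most \<open>2 * h\<close>, and \<open>r \<ge> \<delta>\<close>; this
      explains the choice \<open>\<epsilon> = 2 * (b - a) / \<delta>\<close>.\<close>
    have "2 * h * 1 \<le> 2 * h * (r / \<delta>)" using h r \<delta>(1) by (intro mult_left_mono) auto
    then have er: "2 * h \<le> \<epsilon> * r" by (simp add: \<epsilon>_def h_def)
    have \<epsilon>: "0 \<le> \<epsilon>" "\<epsilon> < 1" using h \<delta>(1) by (auto simp: \<epsilon>_def h_def)
    have up: "R + h \<le> (1 + \<epsilon>) * r" and lo: "(1 - \<epsilon>) * r \<le> R - h"
      using dist_g[OF t] er by (auto simp: r_def algebra_simps)
    have r0: "0 < r" using r \<delta>(1) by simp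
    have "(R + h) powr (n + 2) / (R - h) \<le> ((1 + \<epsilon>) * r) powr (n + 2) / ((1 - \<epsilon>) * r)"
      using up lo \<epsilon> r0 h R n \<delta>(1) by (intro frac_le powr_mono2) auto
    also have "\<dots> = (1 + \<epsilon>) powr (n + 2) / (1 - \<epsilon>) * (r powr (n + 2) / r)"
      using \<epsilon> r0 by (simp add: powr_mult)
    also have "r powr (n + 2) / r = r powr (n + 1)"
      using r0 by (simp add: powr_add field_simps power2_eq_square)
    finally show "(R + h) powr (n + 2) / (R - h) \<le> (1 + \<epsilon>) powr (n + 2) / (1 - \<epsilon>) * dist (g t) p powr (n + 1)"
      by (simp add: r_def)
  qed auto
  finally show ?thesis using n by (simp add: mult_ac divide_simps)
qed

section \<open>Summation over the sectors\<close>

lemma sum_integral_subintervals: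
  fixes f :: "real \<Rightarrow> real"
  assumes "continuous_on {0..h * real N} f" "0 \<le> h"
  shows "(\<Sum>i<N. integral {h * real i..h * real (Suc i)} f) = integral {0..h * real N} f"
  using assms(1)
proof (induction N)
  case (Suc N)
  have le: "0 \<le> h * real N" "h * real N \<le> h * real (Suc N)"
    using assms(2) by (auto intro: mult_left_mono)
  have "continuous_on {0..h * real N} f"
    by (rule continuous_on_subset[OF Suc.prems]) (use le in auto)
  then have "(\<Sum>i<Suc N. integral {h * real i..h * real (Suc i)} f)
      = integral {0..h * real N} f + integral {h * real N..h * real (Suc N)} f"
    using Suc.IH by simp
  also have "\<dots> = integral {0..h * real (Suc N)} f"
    by (intro Henstock_Kurzweil_Integration.integral_combine le integrable_continuous_real Suc.prems)
  finally show ?case .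
qed simp

lemma ex_subinterval:
  assumes "0 \<le> t" "t \<le> h * real N" "0 < N" "0 \<le> h"
  shows "\<exists>i<N. h * real i \<le> t \<and> t \<le> h * real (Suc i)"
  using assms(2,3)
proof (induction N)
  case (Suc N)
  show ?case
  proof (cases "t \<le> h * real N \<and> 0 < N")
    case True
    then show ?thesis using Suc.IH less_Suc_eq by auto
  next
    case False
    then have "h * real N \<le> t" using assms(1) by auto
    then show ?thesis using Suc.prems by blast
  qed
qed simp

text \<open>This is the upper half of the polar formula, with arc length in place of radius times
  angle. Overlaps of the sectors do no harm, as the integrand is nonnegative and only an upper bound
  is sought.\<close>

lemma integral_dist_powr_le_curve:
  fixes K :: "(real ^ 2) set" and g :: "real \<Rightarrow> real ^ 2"
  assumes K: "convex K" "compact K" and p: "p \<in> interior K" and n: "0 < n" and L: "0 < L"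
    and lip: "1-lipschitz_on {0..L} g" and img: "g ` {0..L} = frontier K"
  shows "(\<integral>x. indicator K x * dist x p powr n \<partial>lborel)
    \<le> integral {0..L} (\<lambda>t. dist (g t) p powr (n + 1)) / (n + 2)"
proof -
  obtain \<delta> where \<delta>: "0 < \<delta>" "ball p \<delta> \<subseteq> interior K"
    using p open_interior by (metis open_contains_ball)
  have dist_g: "\<delta> \<le> dist (g t) p" if "t \<in> {0..L}" for t
    using \<delta>(2) that img by (force simp: frontier_def dist_commute)
  have bdd: "bounded K" using K(2) by (rule compact_imp_bounded)
  define S where "S N i = (\<lambda>(r, t). p + r *\<^sub>R (g t - p)) `
    ({0..1} \<times> {L / real N * real i..L / real N * real (Suc i)})" for N i
  define J where "J = integral {0..L} (\<lambda>t. dist (g t) p powr (n + 1))"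
  define X where "X N = (1 + 2 * (L / real N) / \<delta>) powr (n + 2) / (1 - 2 * (L / real N) / \<delta>) / (n + 2) * J" for N
  have cover: "\<exists>i<N. x \<in> S N i" if "x \<in> K" "0 < N" for x N
  proof -
    obtain r t where x: "0 \<le> r" "r \<le> 1" "t \<in> {0..L}" "x = p + r *\<^sub>R (g t - p)"
    proof (cases "x = p")
      case True
      then show ?thesis using that[of 0 0] L by simp
    next
      case False
      then have "x - p \<noteq> 0" by simp
      from ray_to_frontier[OF bdd p this] obtain d where d: "0 < d" "p + d *\<^sub>R (x - p) \<in> frontier K" by blast
      \<comment> \<open>Otherwise the frontier point would lie strictly between \<open>p\<close> and
        \<open>x\<close>, hence in the interior. So \<open>x\<close> lies on the segment from
        \<open>p\<close> to the exit point of its ray.\<close>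
      have "\<not> d < 1"
        using convex_shrink_interior[OF K(1) p \<open>x \<in> K\<close>, of d] d by (auto simp: frontier_def)
      moreover obtain t where "t \<in> {0..L}" "g t = p + d *\<^sub>R (x - p)" using d img by (metis imageE)
      ultimately show ?thesis using that[of "1 / d" t] d by auto
    qed
    obtain i where "i < N" "L / real N * real i \<le> t" "t \<le> L / real N * real (Suc i)"
      using ex_subinterval[of t "L / real N" N] x(3) \<open>0 < N\<close> L by auto
    then have "x \<in> S N i" unfolding S_def using x by force
    with \<open>i < N\<close> show ?thesis by blast
  qed
  have int: "integrable lborel (\<lambda>x. indicator A x * dist x p powr n)" if "compact A" for A
  proof -
    have "continuous_on A (\<lambda>x. dist x p powr n)"
      using n by (intro continuous_on_powr' continuous_intros) auto
    from borel_integrable_compact[OF that this] show ?thesis by simp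
  qed
  have bound: "(\<integral>x. indicator K x * dist x p powr n \<partial>lborel) \<le> X N"
    if N: "0 < N" "2 * (L / real N) < \<delta>" for N
  proof -
    define h where "h = L / real N"
    have h: "0 \<le> h" "h * real N = L" "2 * h < \<delta>" using N L by (auto simp: h_def)
    define a where "a i = h * real i" for i
    have width: "a (Suc i) - a i = h" for i by (simp add: a_def algebra_simps)
    have sub: "{a i..a (Suc i)} \<subseteq> {0..L}" if "i < N" for i
    proof -
      have "0 \<le> a i" using h by (simp add: a_def)
      moreover have "a (Suc i) \<le> L"
        using that h mult_left_mono[of "real (Suc i)" "real N" h] by (simp only: a_def)
      ultimately show ?thesis by auto
    qed
    have lip': "1-lipschitz_on {a i..a (Suc i)} g" if "i < N" for i
      by (rule lipschitz_on_subset[OF lip sub[OF that]])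
    have a_le: "a i \<le> a (Suc i)" for i using width[of i] h by simp
    have S_eq: "S N i = (\<lambda>(r, t). p + r *\<^sub>R (g t - p)) ` ({0..1} \<times> {a i..a (Suc i)})" for i
      by (simp only: S_def a_def h_def)
    have S_compact: "compact (S N i)" if "i < N" for i
      unfolding S_eq
      by (rule sector_area_le(1)[OF a_le lip'[OF that]])
        (use h dist_g[of "a i"] sub[OF that] a_le[of i] width[of i] in auto)
    have "(\<integral>x. indicator K x * dist x p powr n \<partial>lborel)
        \<le> (\<integral>x. (\<Sum>i<N. indicator (S N i) x * dist x p powr n) \<partial>lborel)"
    proof (rule integral_mono)
      fix x
      show "indicator K x * dist x p powr n \<le> (\<Sum>i<N. indicator (S N i) x * dist x p powr n)"
      proof (cases "x \<in> K")
        case True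
        then obtain i where i: "i < N" "x \<in> S N i" using cover N by blast
        have "indicator (S N i) x * dist x p powr n \<le> (\<Sum>i<N. indicator (S N i) x * dist x p powr n)"
          using i by (intro member_le_sum) auto
        then show ?thesis using True i by simp
      qed (simp add: sum_nonneg)
    next
      show "integrable lborel (\<lambda>x. \<Sum>i<N. indicator (S N i) x * dist x p powr n)"
        by (intro Bochner_Integration.integrable_sum int S_compact) auto
    qed (rule int[OF K(2)])
    also have "\<dots> = (\<Sum>i<N. \<integral>x. indicator (S N i) x * dist x p powr n \<partial>lborel)"
      using int S_compact by (intro Bochner_Integration.integral_sum) auto
    also have "\<dots> \<le> (\<Sum>i<N. (1 + 2 * h / \<delta>) powr (n + 2) / (1 - 2 * h / \<delta>) / (n + 2)
        * integral {a i..a (Suc i)} (\<lambda>t. dist (g t) p powr (n + 1)))"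
    proof (rule sum_mono)
      fix i assume "i \<in> {..<N}"
      then have i: "i < N" by simp
      show "(\<integral>x. indicator (S N i) x * dist x p powr n \<partial>lborel) \<le>
        (1 + 2 * h / \<delta>) powr (n + 2) / (1 - 2 * h / \<delta>) / (n + 2)
        * integral {a i..a (Suc i)} (\<lambda>t. dist (g t) p powr (n + 1))"
        using sector_integral_le[OF n a_le lip'[OF i] \<delta>(1), of p] dist_g sub[OF i] h(3)
        unfolding S_eq width by blast
    qed
    also have "\<dots> = (1 + 2 * h / \<delta>) powr (n + 2) / (1 - 2 * h / \<delta>) / (n + 2)
        * (\<Sum>i<N. integral {h * real i..h * real (Suc i)} (\<lambda>t. dist (g t) p powr (n + 1)))"
      by (simp only: a_def sum_distrib_left)
    also have "(\<Sum>i<N. integral {h * real i..h * real (Suc i)} (\<lambda>t. dist (g t) p powr (n + 1))) = J"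
    proof -
      have "continuous_on {0..L} (\<lambda>t. dist (g t) p powr (n + 1))"
        using n by (intro continuous_on_powr' continuous_intros lipschitz_on_continuous_on[OF lip]) auto
      then show ?thesis using sum_integral_subintervals[of h N] h by (simp add: J_def)
    qed
    finally show ?thesis by (simp only: X_def h_def)
  qed
  \<comment> \<open>The bound \<open>\<delta>\<close> is fixed by \<open>p\<close> alone, so the
    relative error is the same for all arcs and vanishes as \<open>N\<close> grows.\<close>
  have h0: "(\<lambda>N. 2 * (L / real N) / \<delta>) \<longlonglongrightarrow> 2 * 0 / \<delta>"
    by (intro tendsto_intros lim_const_over_n) (use \<delta> in auto)
  then have "X \<longlonglongrightarrow> (1 + 2 * 0 / \<delta>) powr (n + 2) / (1 - 2 * 0 / \<delta>) / (n + 2) * J"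
    unfolding X_def by (intro tendsto_intros) (use n \<delta>(1) in auto)
  then have "X \<longlonglongrightarrow> J / (n + 2)" by simp
  moreover have "\<forall>\<^sub>F N in sequentially. (\<integral>x. indicator K x * dist x p powr n \<partial>lborel) \<le> X N"
  proof -
    have "\<forall>\<^sub>F N in sequentially. 2 * (L / real N) / \<delta> < 1"
      using h0 by (rule order_tendstoD) simp
    then show ?thesis
      using eventually_gt_at_top[of 0]
    proof eventually_elim
      case (elim N)
      then have "2 * (L / real N) < \<delta>" using pos_divide_less_eq[OF \<delta>(1), of "2 * (L / real N)" 1] by simp
      with elim show ?case by (intro bound)
    qed
  qed
  ultimately show ?thesis
    unfolding J_def[symmetric] by (intro tendsto_lowerbound[of X]) auto
qed

section \<open>Chords of an arc-length loop and the half-perimeter bound\<close>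

lemma arclength_loop_lipschitz:
  assumes "arclength_loop L g C"
  shows "1-lipschitz_on {0..L} g"
proof (rule lipschitz_on_leI)
  fix s t assume st: "s \<in> {0..L}" "t \<in> {0..L}" "s \<le> t"
  then have "ennreal (dist (g s) (g t)) \<le> ennreal (t - s)"
    using assms dist_le_curve_length[of s t g] by (auto simp: arclength_loop_def)
  then show "dist (g s) (g t) \<le> 1 * dist s t" using st by (simp add: dist_real_def)
qed simp

text \<open>Two points cut the loop into two arcs of total length \<open>L\<close>. The chord is no
  longer than either arc, hence at most half of \<open>L\<close>.\<close>

lemma arclength_loop_dist_le:
  assumes g: "arclength_loop L g C" and xy: "x \<in> C" "y \<in> C"
  shows "dist x y \<le> L / 2"
proof -
  have img: "g ` {0..L} = C" and closed: "g L = g 0" and L: "0 < L"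
    using g by (auto simp: arclength_loop_def)
  have le: "dist (g s) (g t) \<le> L / 2" if st: "s \<in> {0..L}" "t \<in> {0..L}" "s \<le> t" for s t
  proof -
    note lip = lipschitz_onD[OF arclength_loop_lipschitz[OF g]]
    have "dist (g s) (g t) \<le> t - s" using lip[of s t] st by (simp add: dist_real_def)
    moreover have "dist (g s) (g t) \<le> dist (g s) (g 0) + dist (g L) (g t)"
      using closed by (simp add: dist_triangle)
    moreover have "dist (g s) (g 0) \<le> s" "dist (g L) (g t) \<le> L - t"
      using lip[of s 0] lip[of L t] st L by (auto simp: dist_real_def)
    ultimately show ?thesis by simp
  qed
  obtain s t where "s \<in> {0..L}" "t \<in> {0..L}" "x = g s" "y = g t" using xy img by blast
  then show ?thesis using le[of s t] le[of t s] by (cases "s \<le> t") (auto simp: dist_commute)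
qed

lemma integral_dist_powr_le_boundary:
  fixes K :: "(real ^ 2) set"
  assumes K: "convex K" "compact K" and p: "p \<in> interior K" and n: "0 < n"
    and g: "arclength_loop L g (frontier K)"
  shows "(\<integral>x. indicator K x * dist x p powr n \<partial>lborel)
    \<le> L / (2 * (n + 2)) * integral {0..L} (\<lambda>t. dist (g t) p powr n)"
proof -
  have L: "0 < L" and img: "g ` {0..L} = frontier K" using g by (auto simp: arclength_loop_def)
  have lip: "1-lipschitz_on {0..L} g" by (rule arclength_loop_lipschitz[OF g])
  have cont: "continuous_on {0..L} (\<lambda>t. dist (g t) p powr m)" if "0 < m" for m
    using that by (intro continuous_on_powr' continuous_intros lipschitz_on_continuous_on[OF lip]) auto
  have half: "dist (g t) p \<le> L / 2" if "t \<in> {0..L}" for t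
  proof -
    have gt: "g t \<in> frontier K" using img that by blast
    \<comment> \<open>Prolonging the segment from \<open>g t\<close> beyond \<open>p\<close> to the
      boundary gives a chord through \<open>p\<close>, whose length is at most \<open>L / 2\<close>
      and at least the distance to \<open>p\<close>.\<close>
    then have "p - g t \<noteq> 0" using p by (auto simp: frontier_def)
    from ray_to_frontier[OF compact_imp_bounded[OF K(2)] p this]
    obtain d where d: "0 < d" "p + d *\<^sub>R (p - g t) \<in> frontier K" by blast
    have "g t - (p + d *\<^sub>R (p - g t)) = (1 + d) *\<^sub>R (g t - p)" by (simp add: algebra_simps)
    then have "dist (g t) (p + d *\<^sub>R (p - g t)) = (1 + d) * dist (g t) p"
      using d by (simp add: dist_norm)
    moreover have "1 * dist (g t) p \<le> (1 + d) * dist (g t) p" using d by (intro mult_right_mono) auto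
    ultimately show ?thesis using arclength_loop_dist_le[OF g gt d(2)] by simp
  qed
  have "(\<integral>x. indicator K x * dist x p powr n \<partial>lborel)
      \<le> integral {0..L} (\<lambda>t. dist (g t) p powr (n + 1)) / (n + 2)"
    by (rule integral_dist_powr_le_curve[OF K p n L lip img])
  also have "\<dots> \<le> integral {0..L} (\<lambda>t. L / 2 * dist (g t) p powr n) / (n + 2)"
  proof (intro divide_right_mono integral_le integrable_continuous_real continuous_on_mult_left cont)
    fix t assume "t \<in> {0..L}"
    then have "dist (g t) p * dist (g t) p powr n \<le> L / 2 * dist (g t) p powr n"
      using half by (intro mult_right_mono) auto
    then show "dist (g t) p powr (n + 1) \<le> L / 2 * dist (g t) p powr n"
      by (simp add: powr_add mult.commute)
  qed (use n in auto)
  finally show ?thesis by (simp add: mult_ac)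
qed

section \<open>Uniform random points\<close>

lemma integral_uniform_measure:
  fixes f :: "'a \<Rightarrow> real"
  assumes A: "emeasure M A \<noteq> 0" "emeasure M A \<noteq> \<infinity>" and [measurable]: "f \<in> borel_measurable M"
  shows "(\<integral>x. f x \<partial>uniform_measure M A) = (\<integral>x. indicator A x * f x \<partial>M) / measure M A"
proof -
  have [measurable]: "A \<in> sets M" using A(1) by (rule emeasure_neq_0_sets)
  have m: "emeasure M A = ennreal (measure M A)" "0 < measure M A"
    using A by (auto simp: emeasure_eq_ennreal_measure zero_less_measure_iff)
  have "uniform_measure M A = density M (\<lambda>x. ennreal (indicator A x / measure M A))"
    unfolding uniform_measure_def m(1)
    by (intro arg_cong[where f="density M"] ext) (use m(2) in \<open>auto simp: indicator_def divide_ennreal[symmetric]\<close>)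
  then have "(\<integral>x. f x \<partial>uniform_measure M A) = (\<integral>x. (indicator A x / measure M A) * f x \<partial>M)"
    using m(2) by (simp add: integral_density)
  also have "\<dots> = (\<integral>x. (indicator A x * f x) / measure M A \<partial>M)" by simp
  finally show ?thesis by simp
qed

text \<open>The third assumption ties the arc-length measure to the very loop that
  \<open>SOME\<close> selects, so the boundary measure can be computed on
  \<open>{0..L}\<close>.\<close>

locale boundary_loop =
  fixes K :: "(real ^ 2) set" and L :: real and g :: "real \<Rightarrow> real ^ 2"
  assumes K: "convex_body K" and g: "arclength_loop L g (frontier K)"
    and arclength: "arclength_measure (frontier K) = distr (restrict_space lborel {0..L}) borel g"
begin

lemma L: "0 < L" and g_img: "g ` {0..L} = frontier K" and g_cont: "continuous_on {0..L} g"
  using g unfolding arclength_loop_def by blast+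

lemma K': "convex K" "compact K" "interior K \<noteq> {}" "closed K" "bounded K"
  using K compact_imp_closed[of K] compact_imp_bounded[of K] unfolding convex_body_def by blast+

lemma frontier_subset: "frontier K \<subseteq> K"
  using K'(4) by (rule frontier_subset_closed)

lemma g_measurable [measurable]: "g \<in> borel_measurable (restrict_space lborel {0..L})"
proof -
  have "g \<in> borel_measurable (restrict_space borel {0..L})"
    by (rule borel_measurable_continuous_on_restrict[OF g_cont])
  then show ?thesis
    unfolding measurable_cong_sets[OF sets_restrict_space_cong[OF sets_lborel] refl] .
qed

lemma emeasure_boundary: "emeasure (arclength_measure (frontier K)) (frontier K) = ennreal L"
proof -
  have "g -` frontier K \<inter> {0..L} = {0..L}" using g_img by auto
  moreover have "frontier K \<in> sets borel" by simp
  ultimately show ?thesis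
    using L by (simp add: arclength emeasure_distr space_restrict_space emeasure_restrict_space)
qed

lemma perimeter_eq: "perimeter K = L"
  unfolding perimeter_def measure_def emeasure_boundary using L by simp

lemma area_pos: "0 < area K"
proof -
  obtain p where "p \<in> interior K" using K'(3) by blast
  then obtain r where "0 < r" "ball p r \<subseteq> K" unfolding mem_interior by blast
  then have "0 < measure lborel (ball p r)" "measure lborel (ball p r) \<le> measure lborel K"
    using fmeasurable_compact[OF K'(2)] by (auto simp: content_ball_pos intro!: measure_mono_fmeasurable)
  then show ?thesis unfolding area_def by (rule less_le_trans)
qed

lemma emeasure_K: "emeasure lborel K \<noteq> 0" "emeasure lborel K \<noteq> \<infinity>"
proof -
  show "emeasure lborel K \<noteq> 0"
    using area_pos unfolding area_def measure_def by force
  show "emeasure lborel K \<noteq> \<infinity>"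
    using fmeasurable_compact[OF K'(2)] by (simp add: fmeasurableD2)
qed

lemma prob_space_uniform: "prob_space (uniform_in K)" "prob_space (uniform_on_boundary K)"
  using emeasure_K emeasure_boundary L
  by (auto simp: uniform_in_def uniform_on_boundary_def intro!: prob_space_uniform_measure)

lemma sets_uniform: "sets (uniform_in K) = sets borel" "sets (uniform_on_boundary K) = sets borel"
  by (simp_all add: uniform_in_def uniform_on_boundary_def arclength)

lemma AE_uniform: "AE x in uniform_in K. x \<in> K" "AE x in uniform_on_boundary K. x \<in> K"
  unfolding uniform_in_def uniform_on_boundary_def using frontier_subset K'
  by (auto intro!: AE_uniform_measureI simp: arclength borel_compact)

lemma integral_uniform_in:
  fixes f :: "real ^ 2 \<Rightarrow> real"
  assumes "f \<in> borel_measurable borel"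
  shows "(\<integral>x. f x \<partial>uniform_in K) = (\<integral>x. indicator K x * f x \<partial>lborel) / area K"
  using assms emeasure_K by (simp add: uniform_in_def area_def integral_uniform_measure)

lemma integral_uniform_on_boundary:
  fixes f :: "real ^ 2 \<Rightarrow> real"
  assumes f: "continuous_on UNIV f"
  shows "(\<integral>x. f x \<partial>uniform_on_boundary K) = integral {0..L} (\<lambda>t. f (g t)) / L"
proof -
  have [measurable]: "f \<in> borel_measurable borel" using f by (rule borel_measurable_continuous_onI)
  have "(\<integral>x. f x \<partial>uniform_on_boundary K)
      = (\<integral>x. indicator (frontier K) x * f x \<partial>arclength_measure (frontier K)) / perimeter K"
    unfolding uniform_on_boundary_def perimeter_def
    using emeasure_boundary L by (intro integral_uniform_measure) (auto simp: arclength)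
  also have "(\<integral>x. indicator (frontier K) x * f x \<partial>arclength_measure (frontier K))
      = (\<integral>t. indicator (frontier K) (g t) * f (g t) \<partial>restrict_space lborel {0..L})"
    unfolding arclength by (intro integral_distr) auto
  also have "\<dots> = (\<integral>t. indicator {0..L} t * (indicator (frontier K) (g t) * f (g t)) \<partial>lborel)"
    by (subst integral_restrict_space) auto
  also have "\<dots> = (\<integral>t. indicator {0..L} t * f (g t) \<partial>lborel)"
    using g_img by (intro Bochner_Integration.integral_cong) (auto simp: indicator_def)
  also have "\<dots> = integral {0..L} (\<lambda>t. f (g t))"
  proof -
    have "continuous_on {0..L} (\<lambda>t. f (g t))"
      by (rule continuous_on_compose2[OF f g_cont]) auto
    then have "set_integrable lborel {0..L} (\<lambda>t. f (g t))"
      by (rule borel_integrable_atLeastAtMost')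
    from set_borel_integral_eq_integral(2)[OF this] show ?thesis
      by (simp add: set_lebesgue_integral_def)
  qed
  finally show ?thesis by (simp add: perimeter_eq)
qed

lemma dist_bounded: obtains D where "\<And>x y. x \<in> K \<Longrightarrow> y \<in> K \<Longrightarrow> dist x y \<le> D"
  using K'(5) that unfolding bounded_two_points by blast

text \<open>Dominated convergence, with a power of a bound on the distances within \<open>K\<close>
  as majorant. It carries the comparison from interior points to boundary points, for both uniform
  laws.\<close>

lemma tendsto_integral_dist_powr:
  fixes \<mu> :: "(real ^ 2) measure"
  assumes "prob_space \<mu>" and sets: "sets \<mu> = sets borel" and AE: "AE x in \<mu>. x \<in> K"
    and q: "\<And>k. q k \<in> K" "q \<longlonglongrightarrow> p" and n: "0 < n"
  shows "(\<lambda>k. \<integral>x. dist (q k) x powr n \<partial>\<mu>) \<longlonglongrightarrow> (\<integral>x. dist p x powr n \<partial>\<mu>)"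
proof -
  interpret prob_space \<mu> by fact
  obtain D where D: "\<And>x y. x \<in> K \<Longrightarrow> y \<in> K \<Longrightarrow> dist x y \<le> D" using dist_bounded by blast
  note [measurable_cong] = sets
  show ?thesis
  proof (rule integral_dominated_convergence)
    show "AE x in \<mu>. (\<lambda>k. dist (q k) x powr n) \<longlonglongrightarrow> dist p x powr n"
      using n by (intro AE_I2 tendsto_powr' tendsto_intros q) auto
    show "AE x in \<mu>. norm (dist (q k) x powr n) \<le> D powr n" for k
      using AE by eventually_elim (use q D n in \<open>auto intro!: powr_mono2\<close>)
  qed auto
qed

lemma mean_dist_powr_uniform_le:
  assumes n: "1 \<le> n" and iso: "1 / (2 * (n + 2)) \<le> area K / (perimeter K)\<^sup>2" and q: "q \<in> K"
  shows "(\<integral>x. dist q x powr n \<partial>uniform_in K) \<le> (\<integral>x. dist q x powr n \<partial>uniform_on_boundary K)"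
proof -
  have interior: "(\<integral>x. dist p x powr n \<partial>uniform_in K) \<le> (\<integral>x. dist p x powr n \<partial>uniform_on_boundary K)"
    if p: "p \<in> interior K" for p
  proof -
    define J where "J = integral {0..L} (\<lambda>t. dist (g t) p powr n)"
    have J: "0 \<le> J" unfolding J_def
      using n by (intro integral_nonneg integrable_continuous_real continuous_on_powr' continuous_intros g_cont) auto
    have "(\<integral>x. dist p x powr n \<partial>uniform_in K) = (\<integral>x. indicator K x * dist x p powr n \<partial>lborel) / area K"
      by (subst integral_uniform_in) (auto simp: dist_commute)
    also have "\<dots> \<le> (L / (2 * (n + 2)) * J) / area K"
      unfolding J_def using integral_dist_powr_le_boundary[OF K'(1,2) p _ g, of n] n area_pos
      by (intro divide_right_mono) auto
    also have "\<dots> \<le> J / L"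
    proof -
      \<comment> \<open>The isoperimetric threshold is exactly the condition under which the area
        mean is bounded by the boundary mean \<open>J / L\<close>.\<close>
      have "L\<^sup>2 \<le> 2 * (n + 2) * area K" using iso n L by (simp add: perimeter_eq divide_simps mult_ac)
      then have "J * L\<^sup>2 \<le> J * (2 * (n + 2) * area K)" using J by (rule mult_left_mono)
      moreover have "0 < 2 * (n + 2) * area K" using n area_pos by simp
      ultimately have "J * L\<^sup>2 / (2 * (n + 2) * area K) \<le> J" by (subst pos_divide_le_eq)
      then have "J * L\<^sup>2 / (2 * (n + 2) * area K) / L \<le> J / L" using L by (intro divide_right_mono) auto
      then show ?thesis using L by (simp add: power2_eq_square mult_ac)
    qed
    also have "\<dots> = (\<integral>x. dist p x powr n \<partial>uniform_on_boundary K)"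
    proof -
      have "continuous_on UNIV (\<lambda>x. dist p x powr n)"
        using n by (intro continuous_on_powr' continuous_intros) auto
      from integral_uniform_on_boundary[OF this] show ?thesis by (simp add: J_def dist_commute)
    qed
    finally show ?thesis .
  qed
  \<comment> \<open>A convex set with nonempty interior lies in the closure of that interior, so
    \<open>q\<close> is a limit of points covered by the first half.\<close>
  have "q \<in> closure (interior K)"
    using K' q by (simp add: convex_closure_interior)
  then obtain s where s: "\<And>k. s k \<in> interior K" "s \<longlonglongrightarrow> q" unfolding closure_sequential by blast
  have sK: "s k \<in> K" for k using s(1) interior_subset by blast
  show ?thesis
  proof (rule LIMSEQ_le)
    show "(\<lambda>k. \<integral>x. dist (s k) x powr n \<partial>uniform_in K) \<longlonglongrightarrow> (\<integral>x. dist q x powr n \<partial>uniform_in K)"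
      "(\<lambda>k. \<integral>x. dist (s k) x powr n \<partial>uniform_on_boundary K) \<longlonglongrightarrow> (\<integral>x. dist q x powr n \<partial>uniform_on_boundary K)"
      using n by (intro tendsto_integral_dist_powr prob_space_uniform sets_uniform AE_uniform sK s(2); simp)+
  qed (use interior s(1) in auto)
qed

end

text \<open>Existence of some loop makes the \<open>SOME\<close> in \<open>arclength_measure\<close>
  return a genuine one.\<close>

lemma ex_boundary_loop:
  assumes "convex_body K"
  shows "\<exists>L g. boundary_loop K L g"
proof -
  define P where "P = (\<lambda>(L, g). arclength_loop L g (frontier K))"
  obtain L g where Lg: "(SOME p. P p) = (L, g)" by fastforce
  have "\<exists>p. P p" using ex_arclength_loop_frontier[OF assms] by (auto simp: P_def)
  then have "P (SOME p. P p)" by (rule someI_ex)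
  then have "boundary_loop K L g"
    using assms Lg by unfold_locales (auto simp: P_def arclength_measure_def)
  then show ?thesis by blast
qed

section \<open>Independence and conditioning on one of the two points\<close>

context prob_space
begin

lemma indep_vars_imp_indep_var:
  assumes "indep_vars N X I" "i \<in> I" "j \<in> I" "i \<noteq> j"
  shows "indep_var (N i) (X i) (N j) (X j)"
proof -
  have "indep_var (N i) ((\<lambda>f. f i) \<circ> (\<lambda>\<omega>. restrict (\<lambda>i. X i \<omega>) {i}))
      (N j) ((\<lambda>f. f j) \<circ> (\<lambda>\<omega>. restrict (\<lambda>i. X i \<omega>) {j}))"
    using assms by (intro indep_var_compose[OF indep_var_restrict[OF assms(1)]] measurable_component_singleton) auto
  then show ?thesis by (simp add: comp_def)
qed

text \<open>By independence the joint law is a product, and Fubini conditions on \<open>Z\<close>.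
  Integrability of the inner integral is stated as well, because the comparison of two such
  expectations by monotonicity requires it.\<close>

lemma expectation_dist_powr_indep:
  fixes Z W :: "'a \<Rightarrow> real ^ 2"
  assumes ZW: "indep_var borel Z borel W"
    and AE: "AE x in distr M borel Z. x \<in> K" "AE x in distr M borel W. x \<in> K"
    and K: "bounded K" "closed K" and n: "0 \<le> n"
  shows "integrable (distr M borel Z) (\<lambda>x. \<integral>y. dist x y powr n \<partial>distr M borel W)"
    and "expectation (\<lambda>\<omega>. dist (Z \<omega>) (W \<omega>) powr n) = (\<integral>x. (\<integral>y. dist x y powr n \<partial>distr M borel W) \<partial>distr M borel Z)"
proof -
  have [measurable]: "random_variable borel Z" "random_variable borel W"
    using ZW by (auto dest: indep_var_rv1 indep_var_rv2)
  have [measurable]: "K \<in> sets borel" using K(2) by simp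
  interpret P: prob_space "distr M borel Z" by (rule prob_space_distr) measurable
  interpret Q: prob_space "distr M borel W" by (rule prob_space_distr) measurable
  interpret PQ: pair_sigma_finite "distr M borel Z" "distr M borel W" ..
  have eq: "distr M borel Z \<Otimes>\<^sub>M distr M borel W = distr M (borel \<Otimes>\<^sub>M borel) (\<lambda>\<omega>. (Z \<omega>, W \<omega>))"
    using ZW by (simp add: indep_var_distribution_eq)
  obtain D where D: "\<And>x y. x \<in> K \<Longrightarrow> y \<in> K \<Longrightarrow> dist x y \<le> D"
    using K(1) unfolding bounded_two_points by blast
  have AE': "AE \<omega> in M. Z \<omega> \<in> K" "AE \<omega> in M. W \<omega> \<in> K"
    using AE by (auto simp: AE_distr_iff)
  have "integrable M (\<lambda>\<omega>. dist (Z \<omega>) (W \<omega>) powr n)"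
  proof (rule integrable_const_bound)
    show "AE \<omega> in M. norm (dist (Z \<omega>) (W \<omega>) powr n) \<le> D powr n"
      using AE' by eventually_elim (use D n in \<open>auto intro!: powr_mono2\<close>)
  qed measurable
  then have int: "integrable (distr M borel Z \<Otimes>\<^sub>M distr M borel W) (\<lambda>(x, y). dist x y powr n)"
    unfolding eq by (subst integrable_distr_eq) auto
  show "integrable (distr M borel Z) (\<lambda>x. \<integral>y. dist x y powr n \<partial>distr M borel W)"
    using PQ.integrable_fst'[OF int] by simp
  have "expectation (\<lambda>\<omega>. dist (Z \<omega>) (W \<omega>) powr n) = (\<integral>(x, y). dist x y powr n \<partial>(distr M borel Z \<Otimes>\<^sub>M distr M borel W))"
    unfolding eq by (subst integral_distr) auto
  also have "\<dots> = (\<integral>x. (\<integral>y. dist x y powr n \<partial>distr M borel W) \<partial>distr M borel Z)"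
    using PQ.integral_fst'[OF int] by simp
  finally show "expectation (\<lambda>\<omega>. dist (Z \<omega>) (W \<omega>) powr n) = (\<integral>x. (\<integral>y. dist x y powr n \<partial>distr M borel W) \<partial>distr M borel Z)" .
qed

end

text \<open>Both inequalities come from \<open>n + 3 \<le> 2 * (n + 2)\<close>. So the third
  hypothesis of the theorem is the weakest and follows from each of the others.\<close>

lemma threshold_le:
  fixes n :: real
  assumes "1 \<le> n"
  shows "1 / (2 * (n + 2)) \<le> 1 / (n + 3)" "1 / (2 * (n + 2)) \<le> 1 / sqrt (2 * (n + 2) * (n + 3))"
proof -
  show "1 / (2 * (n + 2)) \<le> 1 / (n + 3)" using assms by (intro divide_left_mono) auto
  have "sqrt (2 * (n + 2) * (n + 3)) \<le> sqrt ((2 * (n + 2)) * (2 * (n + 2)))"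
    using assms by (intro real_sqrt_le_mono mult_left_mono) auto
  then have "sqrt (2 * (n + 2) * (n + 3)) \<le> 2 * (n + 2)" using assms by simp
  then show "1 / (2 * (n + 2)) \<le> 1 / sqrt (2 * (n + 2) * (n + 3))"
    using assms by (intro divide_left_mono) auto
qed

theorem theorem3:
  fixes K :: "(real ^ 2) set" and n :: real
    and M :: "'w measure" and X X' Y Y' :: "'w \<Rightarrow> real ^ 2"
  assumes "convex_body K" and "n \<ge> 1"
    and "prob_space M"
    and "prob_space.indep_vars M (\<lambda>_. borel) (\<lambda>i. [X, X', Y, Y'] ! i) {..<4}"
    and "distr M borel X = uniform_in K" and "distr M borel X' = uniform_in K"
    and "distr M borel Y = uniform_on_boundary K" and "distr M borel Y' = uniform_on_boundary K"
  shows "(area K / (perimeter K)\<^sup>2 \<ge> 1 / sqrt (2 * (n + 2) * (n + 3)) \<longrightarrow>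
            (\<integral>\<omega>. dist (X \<omega>) (X' \<omega>) powr n \<partial>M) \<le> (\<integral>\<omega>. dist (Y \<omega>) (Y' \<omega>) powr n \<partial>M)) \<and>
         (area K / (perimeter K)\<^sup>2 \<ge> 1 / (n + 3) \<longrightarrow>
            (\<integral>\<omega>. dist (X \<omega>) (X' \<omega>) powr n \<partial>M) \<le> (\<integral>\<omega>. dist (X \<omega>) (Y \<omega>) powr n \<partial>M)) \<and>
         (area K / (perimeter K)\<^sup>2 \<ge> 1 / (2 * (n + 2)) \<longrightarrow>
            (\<integral>\<omega>. dist (X \<omega>) (Y \<omega>) powr n \<partial>M) \<le> (\<integral>\<omega>. dist (Y \<omega>) (Y' \<omega>) powr n \<partial>M))"
proof -
  interpret prob_space M by fact
  obtain L g where "boundary_loop K L g" using ex_boundary_loop[OF assms(1)] by blast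
  then interpret boundary_loop K L g .
  note law = assms(5-8)
  have indep: "indep_var borel ([X, X', Y, Y'] ! i) borel ([X, X', Y, Y'] ! j)"
    if "i < 4" "j < 4" "i \<noteq> j" for i j
    using indep_vars_imp_indep_var[OF assms(4), of i j] that by simp
  have pairs: "indep_var borel X borel X'" "indep_var borel X borel Y"
    "indep_var borel Y borel X" "indep_var borel Y borel Y'"
    using indep[of 0 1] indep[of 0 2] indep[of 2 0] indep[of 2 3] by simp_all
  \<comment> \<open>Moving one point from \<open>K\<close> to the boundary increases the mean,
    whatever the law of the other point \<open>Z\<close> in \<open>K\<close>. The instances are
    \<open>Z = X\<close> with \<open>X'\<close> replaced by \<open>Y\<close>, and
    \<open>Z = Y\<close> with \<open>X\<close> replaced by \<open>Y'\<close>.\<close>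
  have compare: "expectation (\<lambda>\<omega>. dist (Z \<omega>) (V \<omega>) powr n) \<le> expectation (\<lambda>\<omega>. dist (Z \<omega>) (W \<omega>) powr n)"
    if iso: "1 / (2 * (n + 2)) \<le> area K / (perimeter K)\<^sup>2"
      and ind: "indep_var borel Z borel V" "indep_var borel Z borel W"
      and Z: "AE x in distr M borel Z. x \<in> K"
      and VW: "distr M borel V = uniform_in K" "distr M borel W = uniform_on_boundary K"
    for Z V W
  proof -
    have AE: "AE x in distr M borel V. x \<in> K" "AE x in distr M borel W. x \<in> K"
      unfolding VW by (fact AE_uniform)+
    have "0 \<le> n" using assms(2) by simp
    note V = expectation_dist_powr_indep[OF ind(1) Z AE(1) K'(5,4) this]
      and W = expectation_dist_powr_indep[OF ind(2) Z AE(2) K'(5,4) this]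
    show ?thesis unfolding V(2) W(2)
    proof (rule integral_mono_AE[OF V(1) W(1)])
      show "AE x in distr M borel Z. (\<integral>y. dist x y powr n \<partial>distr M borel V) \<le> (\<integral>y. dist x y powr n \<partial>distr M borel W)"
        using Z by eventually_elim (use mean_dist_powr_uniform_le[OF assms(2) iso] VW in simp)
    qed
  qed
  have XX_XY: "expectation (\<lambda>\<omega>. dist (X \<omega>) (X' \<omega>) powr n) \<le> expectation (\<lambda>\<omega>. dist (X \<omega>) (Y \<omega>) powr n)"
    and XY_YY: "expectation (\<lambda>\<omega>. dist (X \<omega>) (Y \<omega>) powr n) \<le> expectation (\<lambda>\<omega>. dist (Y \<omega>) (Y' \<omega>) powr n)"
    if iso: "1 / (2 * (n + 2)) \<le> area K / (perimeter K)\<^sup>2"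
    using compare[OF iso pairs(1,2), unfolded law] compare[OF iso pairs(3,4), unfolded law] AE_uniform
    by (simp_all add: dist_commute)
  show ?thesis
    \<comment> \<open>The first claim chains the two comparisons through E|XY|^n; the other two
      claims are one comparison each.\<close>
    using XX_XY XY_YY threshold_le[OF assms(2)] by (meson order_trans)
qed

end
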